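(* Let the observed data follow the linear model $\mathbf{y}=\mathbf{H}\mathbf{x}+\mathbf{n}$, where $\mathbf{y}\in\mathbb{C}^{m\times 1}$ is the data vector, $\mathbf{H}\in\mathbb{C}^{m\times n}$ is a known observation matrix, $\mathbf{x}\in\mathbb{C}^{n\times 1}$ is a parameter vector (components $x_1,\dots,x_n$) with prior PDF $\mathcal{CN}(E_{\mathbf{x}}[\mathbf{x}],\mathbf{C}_{\mathbf{x}\mathbf{x}})$, and $\mathbf{n}\in\mathbb{C}^{m\times 1}$ is a zero mean noise vector with covariance matrix $\mathbf{C}_{\mathbf{n}\mathbf{n}}$ and independent of $\mathbf{x}$ (the joint PDF of $\mathbf{x}$ and $\mathbf{n}$ is otherwise arbitrary). Assume that $\mathbf{H}\mathbf{C}_{\mathbf{x}\mathbf{x}}\mathbf{H}^H+\mathbf{C}_{\mathbf{n}\mathbf{n}}$ is invertible and that, for every $i$, $\sigma_{x_i}^2>0$ and $\mathbf{H}\mathbf{C}_{\mathbf{x}x_i}\neq\mathbf{0}$. Consider affine estimators $\hat{\mathbf{x}}=\mathbf{E}\mathbf{y}+\mathbf{c}$ with $\mathbf{E}\in\mathbb{C}^{n\times m}$, $\mathbf{c}\in\mathbb{C}^{n\times 1}$, and let $\hat{x}_i$ be the $i$-th component of $\hat{\mathbf{x}}$. Then the CWCU LMMSE estimator, i.e. the affine estimator that, for each $i=1,\dots,n$, minimizes the Bayesian MSE $E_{\mathbf{y},\mathbf{x}}[|\hat{x}_i-x_i|^2]$ under the constraint $E_{\mathbf{y}|x_i}[\hat{x}_i|x_i]=x_i$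 (for all possible $x_i$), is given by $$\hat{\mathbf{x}}_{\mathrm{CL}}=E_{\mathbf{x}}[\mathbf{x}]+\mathbf{E}_{\mathrm{CL}}(\mathbf{y}-E_{\mathbf{y}}[\mathbf{y}]),\qquad \mathbf{E}_{\mathrm{CL}}=\mathbf{D}\,\mathbf{C}_{\mathbf{x}\mathbf{x}}\mathbf{H}^H(\mathbf{H}\mathbf{C}_{\mathbf{x}\mathbf{x}}\mathbf{H}^H+\mathbf{C}_{\mathbf{n}\mathbf{n}})^{-1},$$ where $\mathbf{D}$ is the real diagonal $n\times n$ matrix with elements $$[\mathbf{D}]_{i,i}=\frac{\sigma_{x_i}^2}{\mathbf{C}_{x_i\mathbf{x}}\mathbf{H}^H(\mathbf{H}\mathbf{C}_{\mathbf{x}\mathbf{x}}\mathbf{H}^H+\mathbf{C}_{\mathbf{n}\mathbf{n}})^{-1}\mathbf{H}\mathbf{C}_{\mathbf{x}x_i}}.$$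
   Context: $(\cdot)^H$ denotes conjugate transpose. For random vectors $\mathbf{u},\mathbf{v}$, $\mathbf{C}_{\mathbf{u}\mathbf{v}}=E[(\mathbf{u}-E[\mathbf{u}])(\mathbf{v}-E[\mathbf{v}])^H]$; in particular $\mathbf{C}_{x_i\mathbf{x}}$ is the $i$-th row and $\mathbf{C}_{\mathbf{x}x_i}$ the $i$-th column of $\mathbf{C}_{\mathbf{x}\mathbf{x}}$. $\sigma_{x_i}^2=[\mathbf{C}_{\mathbf{x}\mathbf{x}}]_{i,i}$ is the variance of $x_i$. $\mathcal{CN}(\boldsymbol{\mu},\mathbf{C})$ is the proper (circularly symmetric about its mean, i.e. zero pseudo-covariance) complex Gaussian distribution with mean $\boldsymbol{\mu}$ and covariance matrix $\mathbf{C}$. The subscript of an expectation operator indicates the distribution over which one averages; $E_{\mathbf{y}|x_i}[\,\cdot\,|x_i]$ is the conditional expectation given $x_i$. CWCU LMMSE stands for "component-wise conditionally unbiased linear minimum mean square error"; "linear" means affine in $\mathbf{y}$. *)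

theory Defs
  imports "HOL-Probability.Probability"
begin

definition adjoint_matrix :: "complex^'n^'m \<Rightarrow> complex^'m^'n"  (\<open>(_\<^sup>H)\<close> [1000] 999) where
  "A\<^sup>H = (\<chi> i j. cnj (A $ j $ i))"

definition cov_matrix ::
    "'a measure \<Rightarrow> ('a \<Rightarrow> complex^'k) \<Rightarrow> ('a \<Rightarrow> complex^'l) \<Rightarrow> complex^'l^'k" where
  "cov_matrix M u v = (\<chi> i j. \<integral>\<omega>. (u \<omega> - (\<integral>\<omega>'. u \<omega>' \<partial>M)) $ i * cnj ((v \<omega> - (\<integral>\<omega>'. v \<omega>' \<partial>M)) $ j) \<partial>M)"

definition pseudo_cov_matrix ::
    "'a measure \<Rightarrow> ('a \<Rightarrow> complex^'k) \<Rightarrow> ('a \<Rightarrow> complex^'l) \<Rightarrow> complex^'l^'k" where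
  "pseudo_cov_matrix M u v = (\<chi> i j. \<integral>\<omega>. (u \<omega> - (\<integral>\<omega>'. u \<omega>' \<partial>M)) $ i * (v \<omega> - (\<integral>\<omega>'. v \<omega>' \<partial>M)) $ j \<partial>M)"

text \<open>Point masses count as (degenerate) normal distributions, so that a singular covariance
  matrix is admitted below.\<close>

definition real_gaussian :: "'a measure \<Rightarrow> ('a \<Rightarrow> real) \<Rightarrow> bool" where
  "real_gaussian M X \<longleftrightarrow>
     (\<exists>\<mu> \<sigma>. \<sigma> > 0 \<and> distributed M lborel X (\<lambda>t. ennreal (normal_density \<mu> \<sigma> t))) \<or>
     (\<exists>\<mu>. AE \<omega> in M. X \<omega> = \<mu>)"

text \<open>The inner product on \<^typ>\<open>complex^'n\<close> is the real one, so \<^term>\<open>a \<bullet> X \<omega>\<close> ranges over all real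
  linear combinations of the real and imaginary parts of the components of \<^term>\<open>X \<omega>\<close>: the second
  conjunct states that these parts are jointly Gaussian.\<close>

definition proper_complex_gaussian ::
    "'a measure \<Rightarrow> ('a \<Rightarrow> complex^'n) \<Rightarrow> complex^'n \<Rightarrow> complex^'n^'n \<Rightarrow> bool" where
  "proper_complex_gaussian M X \<mu> C \<longleftrightarrow>
     X \<in> borel_measurable M \<and>
     (\<forall>a. real_gaussian M (\<lambda>\<omega>. a \<bullet> X \<omega>)) \<and>
     (\<integral>\<omega>. X \<omega> \<partial>M) = \<mu> \<and>
     cov_matrix M X X = C \<and>
     pseudo_cov_matrix M X X = 0"

definition complex_cond_exp ::
    "'a measure \<Rightarrow> 'a measure \<Rightarrow> ('a \<Rightarrow> complex) \<Rightarrow> 'a \<Rightarrow> complex" where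
  "complex_cond_exp M F f =
     (\<lambda>\<omega>. Complex (real_cond_exp M F (\<lambda>\<omega>. Re (f \<omega>)) \<omega>) (real_cond_exp M F (\<lambda>\<omega>. Im (f \<omega>)) \<omega>))"

definition affine_estimator :: "(complex^'m \<Rightarrow> complex^'n) \<Rightarrow> bool" where
  "affine_estimator g \<longleftrightarrow> (\<exists>E c. g = (\<lambda>v. E *v v + c))"

definition bayesian_mse ::
    "'a measure \<Rightarrow> ('a \<Rightarrow> complex^'n) \<Rightarrow> ('a \<Rightarrow> complex^'m) \<Rightarrow> (complex^'m \<Rightarrow> complex^'n) \<Rightarrow> 'n \<Rightarrow> real" where
  "bayesian_mse M x y g i = (\<integral>\<omega>. (cmod (g (y \<omega>) $ i - x \<omega> $ i))\<^sup>2 \<partial>M)"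

text \<open>Conditioning on \<open>x\<^sub>i\<close> is conditioning on the sub-\<open>\<sigma>\<close>-algebra generated by \<open>x\<^sub>i\<close>, and
  the constraint for all possible values of \<open>x\<^sub>i\<close> is read almost surely.\<close>

definition cond_unbiased ::
    "'a measure \<Rightarrow> ('a \<Rightarrow> complex^'n) \<Rightarrow> ('a \<Rightarrow> complex^'m) \<Rightarrow> (complex^'m \<Rightarrow> complex^'n) \<Rightarrow> 'n \<Rightarrow> bool" where
  "cond_unbiased M x y g i \<longleftrightarrow>
     (AE \<omega> in M. complex_cond_exp M (vimage_algebra (space M) (\<lambda>\<omega>. x \<omega> $ i) borel)
                   (\<lambda>\<omega>. g (y \<omega>) $ i) \<omega> = x \<omega> $ i)"

definition is_CWCU_LMMSE ::
    "'a measure \<Rightarrow> ('a \<Rightarrow> complex^'n) \<Rightarrow> ('a \<Rightarrow> complex^'m) \<Rightarrow> (complex^'m \<Rightarrow> complex^'n) \<Rightarrow> bool" where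
  "is_CWCU_LMMSE M x y g \<longleftrightarrow>
     affine_estimator g \<and>
     (\<forall>i. cond_unbiased M x y g i \<and>
          (\<forall>h. affine_estimator h \<and> cond_unbiased M x y h i \<longrightarrow>
               bayesian_mse M x y g i \<le> bayesian_mse M x y h i))"

end

theory Submission
  imports Defs
begin

text \<open>Fix a component \<open>x\<^sub>i\<close>, let \<open>C\<close> be the covariance matrix of \<open>x\<close> and \<open>\<mu>\<close> its mean. The argument has
  two parts: the conditional mean of the data given \<open>x\<^sub>i\<close> is affine in \<open>x\<^sub>i\<close>, which turns the
  unbiasedness constraint into a linear equation; and a definite quadratic form restricted to an
  affine hyperplane has an explicit minimiser.

  For the first part, \<open>E[x\<^sub>j | x\<^sub>i] = \<mu>\<^sub>j + (C\<^sub>j\<^sub>i / C\<^sub>i\<^sub>i) (x\<^sub>i - \<mu>\<^sub>i)\<close> for a proper complex Gaussian vector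
  (\<open>proper_gaussian_regression\<close>). The residual \<open>R\<close> of this regression is uncorrelated with \<open>x\<^sub>i\<close> in the
  real sense, covariance and pseudo-covariance both being zero. For jointly Gaussian variables this
  implies \<open>E[R e^{i a \<bullet> x\<^sub>i}] = 0\<close> for all \<open>a\<close>
  (\<open>uncorrelated_gaussian_orthogonal_iexp\<close>, by differentiating a
  characteristic function), and Fourier uniqueness in the plane (\<open>zero_Fourier_transform_plane\<close>) gives
  \<open>E[R ; x\<^sub>i \<in> B] = 0\<close> for every Borel set \<open>B\<close>. The plane is reduced to Levy's uniqueness theorem on the
  line by treating one real coordinate at a time, which is why complex weights are admitted. Noise
  of mean zero that is independent of \<open>x\<close> does not change the conditional means
  (\<open>linear_gaussian_regression_model\<close>).

  Write \<open>b\<close> for \<open>H\<close> applied to column \<open>i\<close> of \<open>C\<close>, which is the covariance of the data with \<open>x\<^sub>i\<close>,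
  and \<open>G\<close> for the covariance matrix of the data. For an estimate
  \<open>e (y - E y) + \<beta>\<close> of \<open>x\<^sub>i\<close>, conditional unbiasedness says \<open>e b = \<sigma>\<^sup>2\<close> and
  \<open>\<beta> = \<mu>\<^sub>i\<close> (\<open>unbiased_iff\<close>). The row \<open>e\<^sub>0 = (\<sigma>\<^sup>2 / q) b\<^sup>H G\<^sup>-\<^sup>1\<close> with \<open>q = b\<^sup>H G\<^sup>-\<^sup>1 b\<close> satisfies the
  constraint, and \<open>e\<^sub>0 G\<close> is a multiple of \<open>b\<^sup>H\<close>. Hence for every other admissible \<open>e\<close> the combination
  \<open>(e - e\<^sub>0) (y - E y)\<close> is orthogonal to the error of \<open>e\<^sub>0\<close>, and the mean square error grows by exactly
  the second moment of that combination (\<open>constrained_error_decomposition\<close>). As \<open>G\<close> is definite, this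
  excess is positive unless \<open>e = e\<^sub>0\<close> (\<open>comb_degenerate\<close>), which gives optimality and uniqueness at once.
  Definiteness also shows that \<open>q\<close> is real and nonzero.\<close>

section \<open>Weighted laws with vanishing Fourier transform\<close>

lemma law_of_density:
  fixes f T :: "'a \<Rightarrow> real"
  assumes f: "integrable M f" "\<And>\<omega>. 0 \<le> f \<omega>" "(\<integral>\<omega>. f \<omega> \<partial>M) = 1"
    and T [measurable]: "T \<in> borel_measurable M"
  defines "N \<equiv> distr (density M (\<lambda>\<omega>. ennreal (f \<omega>))) borel T"
  shows "real_distribution N"
    and "char N s = (\<integral>\<omega>. f \<omega> *\<^sub>R iexp (s * T \<omega>) \<partial>M)"
    and "A \<in> sets borel \<Longrightarrow> measure N A = (\<integral>\<omega>. f \<omega> * indicator A (T \<omega>) \<partial>M)"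
proof -
  have [measurable]: "f \<in> borel_measurable M"
    using f(1) by simp
  interpret D: prob_space "density M (\<lambda>\<omega>. ennreal (f \<omega>))"
    by (rule prob_spaceI) (use f in \<open>simp add: emeasure_density nn_integral_eq_integral\<close>)
  interpret N: prob_space N
    unfolding N_def by (rule D.prob_space_distr) simp
  show "real_distribution N"
    by unfold_locales (simp_all add: N_def)
  show "char N s = (\<integral>\<omega>. f \<omega> *\<^sub>R iexp (s * T \<omega>) \<partial>M)"
    unfolding char_def N_def using f by (simp add: integral_distr integral_density)
  assume [measurable]: "A \<in> sets borel"
  have "measure N A = (\<integral>t. indicator A t \<partial>N)"
    by (simp add: N_def)
  also have "\<dots> = (\<integral>\<omega>. indicator A (T \<omega>) \<partial>density M (\<lambda>\<omega>. ennreal (f \<omega>)))"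
    unfolding N_def by (intro integral_distr) auto
  also have "\<dots> = (\<integral>\<omega>. f \<omega> * indicator A (T \<omega>) \<partial>M)"
    using f by (subst integral_density) auto
  finally show "measure N A = (\<integral>\<omega>. f \<omega> * indicator A (T \<omega>) \<partial>M)" .
qed

text \<open>Split \<open>W\<close> into positive and negative part. The transform at \<open>0\<close> vanishes, so both parts have
  the same mass; after normalisation each of them is the density of a probability measure, and the
  images of these two measures under \<open>T\<close> have the same characteristic function. Levy's uniqueness
  theorem identifies them.\<close>

lemma zero_Fourier_transform_real:
  fixes W T :: "'a \<Rightarrow> real"
  assumes W: "integrable M W" and T [measurable]: "T \<in> borel_measurable M"
    and zero: "\<And>s. (\<integral>\<omega>. W \<omega> *\<^sub>R iexp (s * T \<omega>) \<partial>M) = 0"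
    and A [measurable]: "A \<in> sets borel"
  shows "(\<integral>\<omega>. W \<omega> * indicator A (T \<omega>) \<partial>M) = 0"
proof -
  define P where "P = (\<lambda>\<omega>. max 0 (W \<omega>))"
  define N where "N = (\<lambda>\<omega>. max 0 (- W \<omega>))"
  have [measurable]: "W \<in> borel_measurable M"
    using W by simp
  have PN: "integrable M P" "integrable M N" "\<And>\<omega>. 0 \<le> P \<omega>" "\<And>\<omega>. 0 \<le> N \<omega>"
      "\<And>\<omega>. W \<omega> = P \<omega> - N \<omega>"
    using W by (auto simp: P_def N_def intro!: integrable_max)
  have [measurable]: "P \<in> borel_measurable M" "N \<in> borel_measurable M"
    by (auto simp: P_def N_def)
  have mult: "integrable M (\<lambda>\<omega>. f \<omega> *\<^sub>R g (T \<omega>))"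
    if "integrable M f" "g \<in> borel_measurable borel" "\<And>t. norm (g t) \<le> 1"
    for f :: "'a \<Rightarrow> real" and g :: "real \<Rightarrow> 'b::{banach, second_countable_topology}"
  proof (rule Bochner_Integration.integrable_bound[OF that(1)])
    show "(\<lambda>\<omega>. f \<omega> *\<^sub>R g (T \<omega>)) \<in> borel_measurable M"
      using that(1,2) by (intro borel_measurable_scaleR) auto
    show "AE \<omega> in M. norm (f \<omega> *\<^sub>R g (T \<omega>)) \<le> norm (f \<omega>)"
      using that(3) by (auto simp: mult_left_le)
  qed
  \<comment> \<open>The common mass of the two parts, by the hypothesis at frequency \<open>0\<close>.\<close>
  define c where "c = (\<integral>\<omega>. P \<omega> \<partial>M)"
  have "complex_of_real (\<integral>\<omega>. W \<omega> \<partial>M) = 0"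
    using zero[of 0] by (simp add: scaleR_conv_of_real)
  then have cN: "(\<integral>\<omega>. N \<omega> \<partial>M) = c"
    using PN by (simp add: c_def)
  have split_eq: "(\<integral>\<omega>. W \<omega> * indicator A (T \<omega>) \<partial>M) =
      (\<integral>\<omega>. P \<omega> * indicator A (T \<omega>) \<partial>M) - (\<integral>\<omega>. N \<omega> * indicator A (T \<omega>) \<partial>M)"
    unfolding PN(5) left_diff_distrib
    using mult[OF PN(1), of "indicator A :: real \<Rightarrow> real"]
      mult[OF PN(2), of "indicator A :: real \<Rightarrow> real"]
    by (intro Bochner_Integration.integral_diff) (simp_all add: abs_indicator)
  show ?thesis
  proof (cases "c = 0")
    case True
    then have "AE \<omega> in M. P \<omega> = 0" "AE \<omega> in M. N \<omega> = 0"
      using integral_nonneg_eq_0_iff_AE[of M P] integral_nonneg_eq_0_iff_AE[of M N] PN cN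
      by (auto simp: c_def)
    then have "AE \<omega> in M. W \<omega> * indicator A (T \<omega>) = 0"
      by eventually_elim (simp add: PN(5))
    then show ?thesis
      by (subst integral_cong_AE[where g = "\<lambda>_. 0"]) auto
  next
    case False
    then have c: "c > 0"
      unfolding c_def using PN(3) by (simp add: order_less_le)
    have p: "integrable M (\<lambda>\<omega>. P \<omega> / c)" "\<And>\<omega>. 0 \<le> P \<omega> / c" "(\<integral>\<omega>. P \<omega> / c \<partial>M) = 1"
      and n: "integrable M (\<lambda>\<omega>. N \<omega> / c)" "\<And>\<omega>. 0 \<le> N \<omega> / c" "(\<integral>\<omega>. N \<omega> / c \<partial>M) = 1"
      using PN c cN by (auto simp: c_def[symmetric])
    note P = law_of_density[OF p T] and N = law_of_density[OF n T]
    have "char (distr (density M (\<lambda>\<omega>. ennreal (P \<omega> / c))) borel T) s =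
        char (distr (density M (\<lambda>\<omega>. ennreal (N \<omega> / c))) borel T) s" for s
    proof -
      have "(\<integral>\<omega>. (P \<omega> / c) *\<^sub>R iexp (s * T \<omega>) \<partial>M) - (\<integral>\<omega>. (N \<omega> / c) *\<^sub>R iexp (s * T \<omega>) \<partial>M)
          = (\<integral>\<omega>. (P \<omega> / c) *\<^sub>R iexp (s * T \<omega>) - (N \<omega> / c) *\<^sub>R iexp (s * T \<omega>) \<partial>M)"
        using mult[OF p(1), of "\<lambda>t. iexp (s * t)"] mult[OF n(1), of "\<lambda>t. iexp (s * t)"]
        by (intro Bochner_Integration.integral_diff[symmetric]) (auto simp del: of_real_mult)
      also have "\<dots> = (\<integral>\<omega>. (1 / c) *\<^sub>R (W \<omega> *\<^sub>R iexp (s * T \<omega>)) \<partial>M)"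
        by (intro Bochner_Integration.integral_cong)
          (simp_all add: PN(5) scaleR_diff_left scaleR_diff_right)
      also have "\<dots> = 0"
        by (subst integral_scaleR_right) (simp only: zero scaleR_zero_right)
      finally show ?thesis
        by (simp only: P(2) N(2)) simp
    qed
    then have "distr (density M (\<lambda>\<omega>. ennreal (P \<omega> / c))) borel T =
        distr (density M (\<lambda>\<omega>. ennreal (N \<omega> / c))) borel T"
      by (intro Levy_uniqueness P N ext)
    then have "(\<integral>\<omega>. P \<omega> / c * indicator A (T \<omega>) \<partial>M) = (\<integral>\<omega>. N \<omega> / c * indicator A (T \<omega>) \<partial>M)"
      unfolding P(3)[OF A, symmetric] N(3)[OF A, symmetric] by (rule arg_cong)
    with c show ?thesis
      by (auto simp: split_eq)
  qed
qed

text \<open>The transform of \<open>cnj W\<close> at \<open>s\<close> is the conjugate of that of \<open>W\<close> at \<open>- s\<close>, so it vanishes as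
  well, and with it the transforms of the real and of the imaginary part of \<open>W\<close>.\<close>

lemma zero_Fourier_transform_complex:
  fixes W :: "'a \<Rightarrow> complex" and T :: "'a \<Rightarrow> real"
  assumes W: "integrable M W" and T [measurable]: "T \<in> borel_measurable M"
    and zero: "\<And>s. (\<integral>\<omega>. W \<omega> * iexp (s * T \<omega>) \<partial>M) = 0"
    and A [measurable]: "A \<in> sets borel"
  shows "(\<integral>\<omega>. W \<omega> * of_real (indicator A (T \<omega>)) \<partial>M) = 0"
proof -
  have [measurable]: "W \<in> borel_measurable M"
    using W by simp
  have int: "integrable M (\<lambda>\<omega>. V \<omega> * g (T \<omega>))"
    if "integrable M V" "g \<in> borel_measurable borel" "\<And>t. norm (g t) \<le> 1"
    for V :: "'a \<Rightarrow> complex" and g :: "real \<Rightarrow> complex"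
  proof (rule Bochner_Integration.integrable_bound[OF that(1)])
    show "(\<lambda>\<omega>. V \<omega> * g (T \<omega>)) \<in> borel_measurable M"
      using that(1,2) by auto
    show "AE \<omega> in M. norm (V \<omega> * g (T \<omega>)) \<le> norm (V \<omega>)"
      using that(3) by (auto simp: norm_mult mult_left_le)
  qed
  have zero': "(\<integral>\<omega>. cnj (W \<omega>) * iexp (s * T \<omega>) \<partial>M) = 0" for s
  proof -
    have "(\<integral>\<omega>. cnj (W \<omega>) * iexp (s * T \<omega>) \<partial>M) = (\<integral>\<omega>. cnj (W \<omega> * iexp ((- s) * T \<omega>)) \<partial>M)"
      by (simp add: exp_cnj)
    then show ?thesis
      by (simp only: Bochner_Integration.integral_cnj zero complex_cnj_zero)
  qed
  have iW: "integrable M (\<lambda>\<omega>. W \<omega> * iexp (s * T \<omega>))"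
    and icW: "integrable M (\<lambda>\<omega>. cnj (W \<omega>) * iexp (s * T \<omega>))" for s
    using int[OF W, of "\<lambda>t. iexp (s * t)"] int[OF integrable_cnj[OF W], of "\<lambda>t. iexp (s * t)"]
    by (auto simp del: of_real_mult)
  have "(\<integral>\<omega>. Re (W \<omega>) *\<^sub>R iexp (s * T \<omega>) \<partial>M) = 0" for s
  proof -
    have "(\<integral>\<omega>. Re (W \<omega>) *\<^sub>R iexp (s * T \<omega>) \<partial>M) =
        (\<integral>\<omega>. (W \<omega> * iexp (s * T \<omega>) + cnj (W \<omega>) * iexp (s * T \<omega>)) / 2 \<partial>M)"
      by (intro Bochner_Integration.integral_cong)
        (auto simp: scaleR_conv_of_real complex_add_cnj simp flip: distrib_right)
    also have "\<dots> = 0"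
      by (simp only: integral_divide_zero Bochner_Integration.integral_add[OF iW icW] zero zero') simp
    finally show ?thesis .
  qed
  moreover have "(\<integral>\<omega>. Im (W \<omega>) *\<^sub>R iexp (s * T \<omega>) \<partial>M) = 0" for s
  proof -
    have "(\<integral>\<omega>. Im (W \<omega>) *\<^sub>R iexp (s * T \<omega>) \<partial>M) =
        (\<integral>\<omega>. (W \<omega> * iexp (s * T \<omega>) - cnj (W \<omega>) * iexp (s * T \<omega>)) / (2 * \<i>) \<partial>M)"
      by (intro Bochner_Integration.integral_cong)
        (simp_all add: scaleR_conv_of_real complex_diff_cnj field_simps flip: left_diff_distrib)
    also have "\<dots> = 0"
      by (simp only: integral_divide_zero Bochner_Integration.integral_diff[OF iW icW] zero zero') simp
    finally show ?thesis .
  qed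
  ultimately have "(\<integral>\<omega>. Re (W \<omega>) * indicator A (T \<omega>) \<partial>M) = 0"
      "(\<integral>\<omega>. Im (W \<omega>) * indicator A (T \<omega>) \<partial>M) = 0"
    using W by (auto intro!: zero_Fourier_transform_real)
  moreover have "integrable M (\<lambda>\<omega>. W \<omega> * of_real (indicator A (T \<omega>)))"
    using int[OF W, of "\<lambda>t. of_real (indicator A t)"] by (auto simp: indicator_def)
  ultimately show ?thesis
    by (intro complex_eqI) (simp_all flip: integral_Re integral_Im)
qed

text \<open>Complex weights make it possible to reduce the plane to the line: for a fixed frequency \<open>t\<close> of
  the imaginary part, \<open>W e^{i t Im Z}\<close> is a weight whose transform along \<open>Re Z\<close> vanishes. Inverting
  first along \<open>Re Z\<close> and then along \<open>Im Z\<close> settles rectangles, and these generate the Borel sets.\<close>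

lemma zero_Fourier_transform_plane:
  fixes W Z :: "'a \<Rightarrow> complex"
  assumes W: "integrable M W" and Z [measurable]: "Z \<in> borel_measurable M"
    and zero: "\<And>a. (\<integral>\<omega>. W \<omega> * iexp (a \<bullet> Z \<omega>) \<partial>M) = 0"
    and B: "B \<in> sets borel"
  shows "(\<integral>\<omega>. W \<omega> * of_real (indicator B (Z \<omega>)) \<partial>M) = 0"
proof -
  have [measurable]: "W \<in> borel_measurable M"
    using W by simp
  have int: "integrable M (\<lambda>\<omega>. W \<omega> * g \<omega>)"
    if "g \<in> borel_measurable M" "\<And>\<omega>. norm (g \<omega>) \<le> 1" for g :: "'a \<Rightarrow> complex"
    by (rule Bochner_Integration.integrable_bound[OF W])
      (use that in \<open>auto simp: norm_mult mult_left_le\<close>)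
  have intB: "integrable M (\<lambda>\<omega>. W \<omega> * of_real (indicator C (Z \<omega>)))"
    if [measurable]: "C \<in> sets borel" for C
    by (intro int) (auto simp: indicator_def)
  have rect: "(\<integral>\<omega>. W \<omega> * of_real (indicator A (Re (Z \<omega>))) * of_real (indicator A' (Im (Z \<omega>))) \<partial>M) = 0"
    if [measurable]: "A \<in> sets borel" "A' \<in> sets borel" for A A'
  proof (rule zero_Fourier_transform_complex)
    show "integrable M (\<lambda>\<omega>. W \<omega> * of_real (indicator A (Re (Z \<omega>))))"
      by (intro int) (auto simp: indicator_def)
    fix t
    have "(\<integral>\<omega>. W \<omega> * iexp (t * Im (Z \<omega>)) * of_real (indicator A (Re (Z \<omega>))) \<partial>M) = 0"
    proof (rule zero_Fourier_transform_complex)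
      show "integrable M (\<lambda>\<omega>. W \<omega> * iexp (t * Im (Z \<omega>)))"
        by (intro int) (auto simp del: of_real_mult)
      show "(\<integral>\<omega>. W \<omega> * iexp (t * Im (Z \<omega>)) * iexp (s * Re (Z \<omega>)) \<partial>M) = 0" for s
        using zero[of "Complex s t"]
        by (simp add: inner_complex_def mult.assoc algebra_simps flip: exp_add)
    qed simp_all
    then show "(\<integral>\<omega>. W \<omega> * of_real (indicator A (Re (Z \<omega>))) * iexp (t * Im (Z \<omega>)) \<partial>M) = 0"
      by (simp add: mult_ac)
  qed simp_all
  have gen: "sets (borel :: complex measure) = sigma_sets UNIV (range (\<lambda>(a, b). box a b))"
    by (subst borel_eq_box) (simp add: sets_measure_of)
  have "box a b \<inter> box c d = box (Complex (max (Re a) (Re c)) (max (Im a) (Im c)))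
      (Complex (min (Re b) (Re d)) (min (Im b) (Im d)))" for a b c d
    by (auto simp: in_box_complex_iff)
  then have "Int_stable (range (\<lambda>(a, b). box a b :: complex set))"
    by (auto simp: Int_stable_def)
  moreover have "range (\<lambda>(a, b). box a b :: complex set) \<subseteq> Pow UNIV"
    by simp
  moreover note B[unfolded gen]
  ultimately show ?thesis
  proof (induction rule: sigma_sets_induct_disjoint)
    case (basic C)
    then obtain a b where C: "C = box a b"
      by auto
    have "indicator C z = (indicator {Re a<..<Re b} (Re z) * indicator {Im a<..<Im b} (Im z) :: real)" for z
      by (auto simp: C in_box_complex_iff indicator_def)
    then show ?case
      using rect[of "{Re a<..<Re b}" "{Im a<..<Im b}"] by (simp add: mult_ac)
  next
    case empty
    show ?case by simp
  next
    case (compl C)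
    then have [measurable]: "C \<in> sets borel"
      by (simp add: gen)
    have "(\<lambda>\<omega>. W \<omega> * of_real (indicator (UNIV - C) (Z \<omega>))) =
        (\<lambda>\<omega>. W \<omega> - W \<omega> * of_real (indicator C (Z \<omega>)))"
      by (auto simp: indicator_def)
    moreover have "(\<integral>\<omega>. W \<omega> \<partial>M) = 0"
      using zero[of 0] by simp
    ultimately show ?case
      using W intB[of C] compl.IH by simp
  next
    case (union C)
    then have C: "C n \<in> sets borel" for n
      by (auto simp: gen)
    have "(\<lambda>n. \<integral>\<omega>. W \<omega> * of_real (indicator (\<Union>i<n. C i) (Z \<omega>)) \<partial>M)
        \<longlonglongrightarrow> (\<integral>\<omega>. W \<omega> * of_real (indicator (\<Union>i. C i) (Z \<omega>)) \<partial>M)"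
    proof (rule integral_dominated_convergence[where w = "\<lambda>\<omega>. norm (W \<omega>)"])
      show "AE \<omega> in M. (\<lambda>n. W \<omega> * of_real (indicator (\<Union>i<n. C i) (Z \<omega>)))
          \<longlonglongrightarrow> W \<omega> * of_real (indicator (\<Union>i. C i) (Z \<omega>))"
        by (intro AE_I2 tendsto_intros LIMSEQ_indicator_UN)
    qed (use W C in \<open>auto simp: indicator_def norm_mult\<close>)
    moreover have "(\<integral>\<omega>. W \<omega> * of_real (indicator (\<Union>i<n. C i) (Z \<omega>)) \<partial>M) = 0" for n
    proof -
      have "indicator (\<Union>i<n. C i) z = (\<Sum>i<n. indicator (C i) z :: real)" for z
        by (rule indicator_UN_disjoint)
          (use union.hyps in \<open>auto simp: disjoint_family_on_def\<close>)
      then show ?thesis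
        using intB C union.IH by (simp add: sum_distrib_left)
    qed
    ultimately show ?case
      by (simp add: LIMSEQ_const_iff)
  qed
qed

section \<open>Uncorrelated jointly Gaussian variables\<close>

context prob_space
begin

text \<open>Expressed by mean and variance instead of the parameters of a density, the formula covers point
  masses as well.\<close>

lemma real_gaussian_characteristic_function:
  assumes "real_gaussian M X" and X [measurable]: "X \<in> borel_measurable M"
  shows "integrable M (\<lambda>\<omega>. (X \<omega>)\<^sup>2)"
    and "expectation (\<lambda>\<omega>. iexp (X \<omega>)) = iexp (expectation X) * exp (- of_real (variance X) / 2)"
proof -
  have "integrable M (\<lambda>\<omega>. (X \<omega>)\<^sup>2) \<and>
    expectation (\<lambda>\<omega>. iexp (X \<omega>)) = iexp (expectation X) * exp (- of_real (variance X) / 2)"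
    using assms(1) unfolding real_gaussian_def
  proof (elim disjE exE conjE)
    fix \<mu> \<sigma> :: real
    assume \<sigma>: "\<sigma> > 0" and D: "distributed M lborel X (\<lambda>t. ennreal (normal_density \<mu> \<sigma> t))"
    have moments: "expectation X = \<mu>" "variance X = \<sigma>\<^sup>2"
      using normal_distributed_expectation[OF \<sigma> D] normal_distributed_variance[OF \<sigma> D] by simp_all
    have S: "distributed M lborel (\<lambda>\<omega>. (X \<omega> - \<mu>) / \<sigma>) (\<lambda>t. ennreal (std_normal_density t))"
      using D normal_standard_normal_convert[OF \<sigma>] by simp
    have std: "distr M borel (\<lambda>\<omega>. (X \<omega> - \<mu>) / \<sigma>) = std_normal_distribution"
      using distributed_distr_eq_density[OF S] by (simp add: distr_def)
    have "integrable M (\<lambda>\<omega>. X \<omega> - \<mu>)" "integrable M (\<lambda>\<omega>. (X \<omega> - \<mu>)\<^sup>2)"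
      using distributed_integrable[OF D, of "\<lambda>t. t - \<mu>"] integrable_normal_moment[OF \<sigma>, of \<mu> 1]
        distributed_integrable[OF D, of "\<lambda>t. (t - \<mu>)\<^sup>2"] integrable_normal_moment[OF \<sigma>, of \<mu> 2]
      by simp_all
    then have "integrable M (\<lambda>\<omega>. (X \<omega> - \<mu>)\<^sup>2 + 2 * \<mu> * (X \<omega> - \<mu>) + \<mu>\<^sup>2)"
      by simp
    also have "(\<lambda>\<omega>. (X \<omega> - \<mu>)\<^sup>2 + 2 * \<mu> * (X \<omega> - \<mu>) + \<mu>\<^sup>2) = (\<lambda>\<omega>. (X \<omega>)\<^sup>2)"
      by (simp add: power2_eq_square algebra_simps)
    finally have "integrable M (\<lambda>\<omega>. (X \<omega>)\<^sup>2)" .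
    moreover have "X \<omega> = \<mu> + \<sigma> * ((X \<omega> - \<mu>) / \<sigma>)" for \<omega>
      using \<sigma> by simp
    then have "iexp (X \<omega>) = iexp \<mu> * iexp (\<sigma> * ((X \<omega> - \<mu>) / \<sigma>))" for \<omega>
      by (metis distrib_left exp_add of_real_add)
    then have "expectation (\<lambda>\<omega>. iexp (X \<omega>)) = iexp \<mu> * expectation (\<lambda>\<omega>. iexp (\<sigma> * ((X \<omega> - \<mu>) / \<sigma>)))"
      by (simp only: integral_mult_right_zero)
    moreover have "expectation (\<lambda>\<omega>. iexp (\<sigma> * ((X \<omega> - \<mu>) / \<sigma>))) = char std_normal_distribution \<sigma>"
      unfolding std[symmetric] char_def by (subst integral_distr) auto
    ultimately show ?thesis
      by (subst moments(2), subst moments(1)) (simp add: char_std_normal_distribution flip: exp_of_real)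
  next
    fix \<mu> :: real
    assume \<mu>: "AE \<omega> in M. X \<omega> = \<mu>"
    have c: "expectation (\<lambda>\<omega>. g (X \<omega>)) = g \<mu>" if "g \<in> borel_measurable borel"
      for g :: "real \<Rightarrow> 'b::{banach, second_countable_topology}"
      using that \<mu> by (subst integral_cong_AE[where g = "\<lambda>_. g \<mu>"]) (auto simp: prob_space)
    have "integrable M (\<lambda>\<omega>. (X \<omega>)\<^sup>2)"
      using \<mu> by (subst integrable_cong_AE[where g = "\<lambda>_. \<mu>\<^sup>2"]) auto
    moreover have "expectation X = \<mu>"
      using c[of "\<lambda>t. t"] by simp
    moreover have "variance X = 0"
      unfolding \<open>expectation X = \<mu>\<close> using c[of "\<lambda>t. (t - \<mu>)\<^sup>2"] by simp
    moreover have "expectation (\<lambda>\<omega>. iexp (X \<omega>)) = iexp \<mu>"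
      by (rule c) simp
    ultimately show ?thesis
      by simp
  qed
  then show "integrable M (\<lambda>\<omega>. (X \<omega>)\<^sup>2)"
    and "expectation (\<lambda>\<omega>. iexp (X \<omega>)) = iexp (expectation X) * exp (- of_real (variance X) / 2)"
    by simp_all
qed

text \<open>As \<open>U\<close> and \<open>V\<close> are uncorrelated, the variance of \<open>t U + V\<close> is \<open>t\<^sup>2 Var U + Var V\<close>, so
  \<open>E[e^{i(tU + V)}]\<close> depends on \<open>t\<close> only through \<open>exp (- t\<^sup>2 Var U / 2)\<close>, which has derivative \<open>0\<close> at
  \<open>t = 0\<close>. Differentiation under the expectation gives \<open>i E[U e^{iV}]\<close> for the same derivative.\<close>

lemma uncorrelated_gaussian_orthogonal_iexp:
  fixes U V :: "'a \<Rightarrow> real"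
  assumes [measurable]: "U \<in> borel_measurable M" "V \<in> borel_measurable M"
    and gauss: "\<And>t s. real_gaussian M (\<lambda>\<omega>. t * U \<omega> + s * V \<omega>)"
    and U0: "expectation U = 0" and UV: "expectation (\<lambda>\<omega>. U \<omega> * (V \<omega> - expectation V)) = 0"
  shows "expectation (\<lambda>\<omega>. U \<omega> *\<^sub>R iexp (V \<omega>)) = 0"
proof -
  have U: "integrable M (\<lambda>\<omega>. (U \<omega>)\<^sup>2)" and V: "integrable M (\<lambda>\<omega>. (V \<omega>)\<^sup>2)"
    using real_gaussian_characteristic_function(1)[OF gauss[of 1 0]]
      real_gaussian_characteristic_function(1)[OF gauss[of 0 1]] by simp_all
  have iU: "integrable M U" and iV: "integrable M V"
    using U V by (auto intro: square_integrable_imp_integrable)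
  define m where "m = expectation V"
  have iV2: "integrable M (\<lambda>\<omega>. (V \<omega> - m)\<^sup>2)"
    using V iV by (simp add: power2_diff)
  have iUV: "integrable M (\<lambda>\<omega>. U \<omega> * (V \<omega> - m))"
  proof (rule Bochner_Integration.integrable_bound[OF Bochner_Integration.integrable_add[OF U iV2]])
    have "\<bar>u * v\<bar> \<le> u\<^sup>2 + v\<^sup>2" for u v :: real
      using sum_squares_bound[of "\<bar>u\<bar>" "\<bar>v\<bar>"] mult_nonneg_nonneg[of "\<bar>u\<bar>" "\<bar>v\<bar>"]
      unfolding abs_mult power2_abs by linarith
    then show "AE \<omega> in M. norm (U \<omega> * (V \<omega> - m)) \<le> norm ((U \<omega>)\<^sup>2 + (V \<omega> - m)\<^sup>2)"
      by auto
  qed simp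
  define a b where "a = expectation (\<lambda>\<omega>. (U \<omega>)\<^sup>2)" and "b = variance V"
  define K where "K = iexp m * exp (- complex_of_real b / 2)"
  have char: "expectation (\<lambda>\<omega>. iexp (t * U \<omega> + V \<omega>)) = K * of_real (exp (- t\<^sup>2 * a / 2))" for t
  proof -
    have mean: "expectation (\<lambda>\<omega>. t * U \<omega> + V \<omega>) = m"
      using iU iV U0 by (simp add: m_def)
    have "variance (\<lambda>\<omega>. t * U \<omega> + V \<omega>) =
        expectation (\<lambda>\<omega>. t\<^sup>2 * (U \<omega>)\<^sup>2 + 2 * t * (U \<omega> * (V \<omega> - m)) + (V \<omega> - m)\<^sup>2)"
      unfolding mean by (simp add: power2_eq_square algebra_simps)
    also have "\<dots> = t\<^sup>2 * a + b"
      using U iUV iV2 UV by (simp add: a_def b_def m_def)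
    finally have "expectation (\<lambda>\<omega>. iexp (t * U \<omega> + V \<omega>)) =
        iexp m * exp (- of_real (t\<^sup>2 * a + b) / 2)"
      using real_gaussian_characteristic_function(2)[OF gauss[of t 1]] mean by simp
    also have "\<dots> = K * of_real (exp (- t\<^sup>2 * a / 2))"
      by (simp add: K_def mult.assoc add_divide_distrib diff_divide_distrib algebra_simps flip: exp_of_real exp_add)
    finally show ?thesis .
  qed
  define t :: "nat \<Rightarrow> real" where "t n = 1 / real (Suc n)" for n
  have t0: "t n \<noteq> 0" for n
    by (simp add: t_def)
  have t: "filterlim t (at 0) sequentially"
    unfolding filterlim_at using LIMSEQ_inverse_real_of_nat t0
    by (auto simp: t_def[abs_def] inverse_eq_divide)
  \<comment> \<open>The difference quotients at \<open>0\<close> along \<open>t n = 1 / (n + 1)\<close>; they are dominated by \<open>\<bar>U\<bar>\<close>.\<close>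
  have lim: "(\<lambda>n. (iexp (t n * u) - 1) / of_real (t n)) \<longlonglongrightarrow> \<i> * of_real u" for u
  proof -
    have "((\<lambda>z. exp (\<i> * of_real u * z)) has_field_derivative \<i> * of_real u) (at 0)"
      by (auto intro!: derivative_eq_intros)
    then have "((\<lambda>z. (exp (\<i> * of_real u * z) - 1) / z) \<longlongrightarrow> \<i> * of_real u) (at 0)"
      by (simp add: DERIV_def)
    moreover have "filterlim (\<lambda>n. complex_of_real (t n)) (at 0) sequentially"
      using t unfolding filterlim_at by (auto intro: tendsto_of_real[where 'a = complex and a = 0, simplified])
    ultimately show ?thesis
      by (auto dest: filterlim_compose simp: mult_ac)
  qed
  have "(\<lambda>n. expectation (\<lambda>\<omega>. (iexp (t n * U \<omega>) - 1) / of_real (t n) * iexp (V \<omega>)))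
      \<longlonglongrightarrow> expectation (\<lambda>\<omega>. \<i> * of_real (U \<omega>) * iexp (V \<omega>))"
  proof (rule integral_dominated_convergence[where w = "\<lambda>\<omega>. \<bar>U \<omega>\<bar>"])
    show "AE \<omega> in M. norm ((iexp (t n * U \<omega>) - 1) / of_real (t n) * iexp (V \<omega>)) \<le> \<bar>U \<omega>\<bar>" for n
    proof (rule AE_I2)
      fix \<omega>
      have "cmod (iexp (t n * U \<omega>) - 1) \<le> \<bar>t n * U \<omega>\<bar>"
        using iexp_approx1[of "t n * U \<omega>" 0] by simp
      then have "cmod (iexp (t n * U \<omega>) - 1) / \<bar>t n\<bar> \<le> \<bar>U \<omega>\<bar>"
        using t0[of n] by (simp add: pos_divide_le_eq abs_mult mult.commute)
      then show "norm ((iexp (t n * U \<omega>) - 1) / of_real (t n) * iexp (V \<omega>)) \<le> \<bar>U \<omega>\<bar>"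
        by (simp add: norm_mult norm_divide)
    qed
    show "AE \<omega> in M. (\<lambda>n. (iexp (t n * U \<omega>) - 1) / of_real (t n) * iexp (V \<omega>))
        \<longlonglongrightarrow> \<i> * of_real (U \<omega>) * iexp (V \<omega>)"
      by (intro AE_I2 tendsto_mult lim tendsto_const)
  qed (use iU in auto)
  moreover have "expectation (\<lambda>\<omega>. (iexp (t n * U \<omega>) - 1) / of_real (t n) * iexp (V \<omega>)) =
      K * of_real ((exp (- (t n)\<^sup>2 * a / 2) - 1) / t n)" for n
  proof -
    have "(iexp (t n * U \<omega>) - 1) / of_real (t n) * iexp (V \<omega>) =
        (iexp (t n * U \<omega> + V \<omega>) - iexp (0 * U \<omega> + V \<omega>)) / of_real (t n)" for \<omega>
      by (simp add: field_simps exp_add)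
    then have "expectation (\<lambda>\<omega>. (iexp (t n * U \<omega>) - 1) / of_real (t n) * iexp (V \<omega>)) =
      (expectation (\<lambda>\<omega>. iexp (t n * U \<omega> + V \<omega>)) - expectation (\<lambda>\<omega>. iexp (0 * U \<omega> + V \<omega>))) / of_real (t n)"
      by (simp only: integral_divide_zero)
        (subst Bochner_Integration.integral_diff; auto intro!: integrable_iexp simp del: of_real_add of_real_mult)
    then show ?thesis
      unfolding char by (simp add: field_simps)
  qed
  moreover have "(\<lambda>n. K * of_real ((exp (- (t n)\<^sup>2 * a / 2) - 1) / t n)) \<longlonglongrightarrow> K * of_real 0"
  proof -
    have "((\<lambda>s. exp (- s\<^sup>2 * a / 2)) has_field_derivative 0) (at 0)"
      by (auto intro!: derivative_eq_intros)
    then have "((\<lambda>s. (exp (- s\<^sup>2 * a / 2) - 1) / s) \<longlongrightarrow> 0) (at 0)"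
      by (simp add: DERIV_def)
    then show ?thesis
      by (intro tendsto_intros) (rule filterlim_compose[OF _ t])
  qed
  ultimately have "expectation (\<lambda>\<omega>. \<i> * of_real (U \<omega>) * iexp (V \<omega>)) = K * of_real 0"
    by (simp only: LIMSEQ_unique)
  then show ?thesis
    by (simp add: scaleR_conv_of_real mult.assoc)
qed

end

section \<open>Square-integrable complex random variables\<close>

definition square_integrable :: "'a measure \<Rightarrow> ('a \<Rightarrow> complex) \<Rightarrow> bool" where
  "square_integrable M f \<longleftrightarrow> f \<in> borel_measurable M \<and> integrable M (\<lambda>\<omega>. (cmod (f \<omega>))\<^sup>2)"

lemma square_integrable_measurable [measurable_dest]:
  "square_integrable M f \<Longrightarrow> f \<in> borel_measurable M"
  by (simp add: square_integrable_def)

lemma square_integrable_mult: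
  assumes "square_integrable M f" "square_integrable M g"
  shows "integrable M (\<lambda>\<omega>. f \<omega> * g \<omega>)"
proof (rule Bochner_Integration.integrable_bound)
  show "integrable M (\<lambda>\<omega>. (cmod (f \<omega>))\<^sup>2 + (cmod (g \<omega>))\<^sup>2)"
    using assms by (simp add: square_integrable_def)
  show "(\<lambda>\<omega>. f \<omega> * g \<omega>) \<in> borel_measurable M"
    using assms by (auto simp: square_integrable_def)
  have "u * v \<le> u\<^sup>2 + v\<^sup>2" if "u \<ge> 0" "v \<ge> 0" for u v :: real
    using sum_squares_bound[of u v] mult_nonneg_nonneg[OF that] by linarith
  then show "AE \<omega> in M. norm (f \<omega> * g \<omega>) \<le> norm ((cmod (f \<omega>))\<^sup>2 + (cmod (g \<omega>))\<^sup>2)"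
    by (auto simp: norm_mult)
qed

lemma square_integrable_cnj [simp]:
  "square_integrable M f \<Longrightarrow> square_integrable M (\<lambda>\<omega>. cnj (f \<omega>))"
  by (auto simp: square_integrable_def intro: borel_measurable_continuous_on[where f = cnj] continuous_intros)

lemma square_integrable_cmult [simp]:
  "square_integrable M f \<Longrightarrow> square_integrable M (\<lambda>\<omega>. c * f \<omega>)"
  by (auto simp: square_integrable_def norm_mult power_mult_distrib)

lemma square_integrable_add [simp]:
  assumes "square_integrable M f" "square_integrable M g"
  shows "square_integrable M (\<lambda>\<omega>. f \<omega> + g \<omega>)"
proof -
  have "integrable M (\<lambda>\<omega>. Re (f \<omega> * cnj (g \<omega>)))"
    by (intro integrable_Re square_integrable_mult square_integrable_cnj assms)
  then have "integrable M (\<lambda>\<omega>. (cmod (f \<omega>))\<^sup>2 + (cmod (g \<omega>))\<^sup>2 + 2 * Re (f \<omega> * cnj (g \<omega>)))"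
    using assms unfolding square_integrable_def
    by (intro Bochner_Integration.integrable_add integrable_mult_right) blast+
  also have "(\<lambda>\<omega>. (cmod (f \<omega>))\<^sup>2 + (cmod (g \<omega>))\<^sup>2 + 2 * Re (f \<omega> * cnj (g \<omega>))) =
      (\<lambda>\<omega>. (cmod (f \<omega> + g \<omega>))\<^sup>2)"
    by (simp add: cmod_power2) (simp add: power2_eq_square algebra_simps)
  finally show ?thesis
    using assms by (auto simp: square_integrable_def)
qed

lemma square_integrable_diff [simp]:
  assumes "square_integrable M f" "square_integrable M g"
  shows "square_integrable M (\<lambda>\<omega>. f \<omega> - g \<omega>)"
  using square_integrable_add[OF assms(1) square_integrable_cmult[OF assms(2), of "-1"]] by simp

lemma square_integrable_sum [simp]:
  assumes "\<And>k. k \<in> A \<Longrightarrow> square_integrable M (f k)"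
  shows "square_integrable M (\<lambda>\<omega>. \<Sum>k\<in>A. f k \<omega>)"
  using assms by (induction A rule: infinite_finite_induct) (auto simp: square_integrable_def[of _ "\<lambda>_. 0"])

lemma integrable_vec:
  fixes f :: "'a \<Rightarrow> complex^'n"
  assumes "\<And>k. integrable M (\<lambda>\<omega>. f \<omega> $ k)" "f \<in> borel_measurable M"
  shows "integrable M f"
proof (rule Bochner_Integration.integrable_bound)
  show "integrable M (\<lambda>\<omega>. \<Sum>k\<in>UNIV. cmod (f \<omega> $ k))"
    using assms by simp
  show "AE \<omega> in M. norm (f \<omega>) \<le> norm (\<Sum>k\<in>UNIV. cmod (f \<omega> $ k))"
    by (intro AE_I2) (simp add: norm_vec_def L2_set_le_sum sum_nonneg)
qed (use assms in simp)

lemma integral_vec_nth: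
  fixes f :: "'a \<Rightarrow> complex^'n"
  assumes "integrable M f"
  shows "integrable M (\<lambda>\<omega>. f \<omega> $ k)" "(\<integral>\<omega>. f \<omega> \<partial>M) $ k = (\<integral>\<omega>. f \<omega> $ k \<partial>M)"
  using integrable_bounded_linear[OF bounded_linear_vec_nth assms]
    integral_bounded_linear[OF bounded_linear_vec_nth assms] by auto

lemma borel_measurable_vec_nth [measurable (raw)]:
  fixes f :: "'a \<Rightarrow> complex^'n"
  assumes "f \<in> borel_measurable M"
  shows "(\<lambda>\<omega>. f \<omega> $ k) \<in> borel_measurable M"
  using assms by (rule measurable_compose) (intro borel_measurable_continuous_onI continuous_intros)

context prob_space
begin

lemma square_integrable_const [simp]: "square_integrable M (\<lambda>_. c)"
  by (simp add: square_integrable_def)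

lemma square_integrable_integrable:
  assumes "square_integrable M f" shows "integrable M f"
  using square_integrable_mult[OF assms, of "\<lambda>_. 1"] by simp

end

section \<open>Conditional means of proper complex Gaussian vectors\<close>

context prob_space
begin

lemma real_gaussian_add_const:
  assumes "real_gaussian M X"
  shows "real_gaussian M (\<lambda>\<omega>. \<beta> + X \<omega>)"
  using assms unfolding real_gaussian_def
proof (elim disjE exE conjE)
  fix \<mu> \<sigma> :: real
  assume "\<sigma> > 0" "distributed M lborel X (\<lambda>t. ennreal (normal_density \<mu> \<sigma> t))"
  then have "distributed M lborel (\<lambda>\<omega>. \<beta> + 1 * X \<omega>)
      (\<lambda>t. ennreal (normal_density (\<beta> + 1 * \<mu>) (\<bar>1\<bar> * \<sigma>) t))"
    by (intro normal_density_affine) auto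
  then show "(\<exists>\<mu> \<sigma>. \<sigma> > 0 \<and> distributed M lborel (\<lambda>\<omega>. \<beta> + X \<omega>) (\<lambda>t. ennreal (normal_density \<mu> \<sigma> t))) \<or>
      (\<exists>\<mu>. AE \<omega> in M. \<beta> + X \<omega> = \<mu>)"
    using \<open>\<sigma> > 0\<close> by auto
qed auto

text \<open>The entries of the covariance matrices are Bochner integrals, which carry information only for
  integrable functions. Gaussianity of the real and imaginary parts of the components supplies the
  second moments.\<close>

lemma proper_complex_gaussian_moments:
  fixes X :: "'a \<Rightarrow> complex^'n"
  assumes X: "proper_complex_gaussian M X \<mu> C"
  shows "square_integrable M (\<lambda>\<omega>. (X \<omega> - \<mu>) $ j)"
    and "integrable M X"
    and "expectation (\<lambda>\<omega>. (X \<omega> - \<mu>) $ j) = 0"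
    and "expectation (\<lambda>\<omega>. (X \<omega> - \<mu>) $ j * cnj ((X \<omega> - \<mu>) $ k)) = C $ j $ k"
    and "expectation (\<lambda>\<omega>. (X \<omega> - \<mu>) $ j * (X \<omega> - \<mu>) $ k) = 0"
proof -
  have [measurable]: "X \<in> borel_measurable M" and gauss: "\<And>a. real_gaussian M (\<lambda>\<omega>. a \<bullet> X \<omega>)"
    and \<mu>: "expectation X = \<mu>" and C: "cov_matrix M X X = C" and P: "pseudo_cov_matrix M X X = 0"
    using X by (auto simp: proper_complex_gaussian_def)
  have sq: "square_integrable M (\<lambda>\<omega>. X \<omega> $ j)" for j
  proof -
    have "integrable M (\<lambda>\<omega>. (a \<bullet> X \<omega> $ j)\<^sup>2)" for a
      using real_gaussian_characteristic_function(1)[OF gauss[of "axis j a"]] by (simp add: inner_axis')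
    from this[of 1] this[of \<i>] show ?thesis
      by (simp add: square_integrable_def cmod_power2 inner_complex_def)
  qed
  then show "square_integrable M (\<lambda>\<omega>. (X \<omega> - \<mu>) $ j)"
    by simp
  show int: "integrable M X"
    using sq by (intro integrable_vec square_integrable_integrable) auto
  show "expectation (\<lambda>\<omega>. (X \<omega> - \<mu>) $ j) = 0"
    using integral_vec_nth[OF int] \<mu> by (simp add: prob_space)
  show "expectation (\<lambda>\<omega>. (X \<omega> - \<mu>) $ j * cnj ((X \<omega> - \<mu>) $ k)) = C $ j $ k"
    using C \<mu> by (auto simp: cov_matrix_def)
  have "pseudo_cov_matrix M X X $ j $ k = 0"
    using P by simp
  then show "expectation (\<lambda>\<omega>. (X \<omega> - \<mu>) $ j * (X \<omega> - \<mu>) $ k) = 0"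
    using \<mu> by (simp add: pseudo_cov_matrix_def)
qed

lemma inner_complex_mult_left: "inner c (\<kappa> * w) = inner (cnj \<kappa> * c) (w :: complex)"
  by (simp add: inner_complex_def algebra_simps)

text \<open>The residual \<open>R\<close> of the linear regression of component \<open>j\<close> on component \<open>i\<close> satisfies
  \<open>E[R cnj z] = 0\<close> by the choice of the coefficient, where \<open>z\<close> is the centred component \<open>i\<close>, and
  \<open>E[R z] = 0\<close> because the pseudo-covariance vanishes. Together they say that the real and imaginary parts
  of \<open>R\<close> are uncorrelated with those of \<open>z\<close>. Gaussianity turns this into \<open>E[R e^{i a \<bullet> X\<^sub>i}] = 0\<close> for all \<open>a\<close>, and Fourier uniqueness yields the
  conclusion, which is \<open>E[R | X\<^sub>i] = 0\<close>.\<close>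

lemma proper_gaussian_regression:
  fixes X :: "'a \<Rightarrow> complex^'n"
  assumes X: "proper_complex_gaussian M X \<mu> C" and Ci: "C $ i $ i \<noteq> 0" and B: "B \<in> sets borel"
  shows "expectation (\<lambda>\<omega>. ((X \<omega> - \<mu>) $ j - C $ j $ i / C $ i $ i * (X \<omega> - \<mu>) $ i) *
      of_real (indicator B (X \<omega> $ i))) = 0"
proof -
  define \<kappa> where "\<kappa> = C $ j $ i / C $ i $ i"
  define z where "z k \<omega> = (X \<omega> - \<mu>) $ k" for k \<omega>
  define R where "R \<omega> = z j \<omega> - \<kappa> * z i \<omega>" for \<omega>
  note mom = proper_complex_gaussian_moments[OF X, folded z_def]
  have gauss: "\<And>a. real_gaussian M (\<lambda>\<omega>. a \<bullet> X \<omega>)" and [measurable]: "X \<in> borel_measurable M"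
    using X by (auto simp: proper_complex_gaussian_def)
  have sqz: "square_integrable M (z k)" for k
    using mom(1) by (simp add: z_def[abs_def])
  have sqR: "square_integrable M R"
    unfolding R_def[abs_def] using sqz by simp
  have iR: "integrable M R"
    by (rule square_integrable_integrable[OF sqR])
  have ER: "expectation R = 0"
    unfolding R_def[abs_def] using sqz mom(3) by (simp add: square_integrable_integrable)
  have iRz: "integrable M (\<lambda>\<omega>. R \<omega> * z i \<omega>)" and iRcz: "integrable M (\<lambda>\<omega>. R \<omega> * cnj (z i \<omega>))"
    using sqR sqz by (auto intro: square_integrable_mult)
  have ERz: "expectation (\<lambda>\<omega>. R \<omega> * z i \<omega>) = 0"
    using mom(5) by (simp add: R_def left_diff_distrib mult.assoc square_integrable_mult sqz)
  have ERcz: "expectation (\<lambda>\<omega>. R \<omega> * cnj (z i \<omega>)) = 0"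
    using mom(4) Ci by (simp add: R_def left_diff_distrib mult.assoc square_integrable_mult sqz \<kappa>_def)
  \<comment> \<open>The values \<open>c = 1\<close> and \<open>c = \<i>\<close> give the real and the imaginary part of \<open>R\<close>.\<close>
  have part: "expectation (\<lambda>\<omega>. (c \<bullet> R \<omega>) *\<^sub>R iexp (a \<bullet> X \<omega> $ i)) = 0" for a c
  proof (rule uncorrelated_gaussian_orthogonal_iexp)
    show "(\<lambda>\<omega>. c \<bullet> R \<omega>) \<in> borel_measurable M" "(\<lambda>\<omega>. a \<bullet> X \<omega> $ i) \<in> borel_measurable M"
      using sqR by measurable
    show "expectation (\<lambda>\<omega>. c \<bullet> R \<omega>) = 0"
      using iR ER by simp
    have mean: "expectation (\<lambda>\<omega>. a \<bullet> X \<omega> $ i) = a \<bullet> \<mu> $ i"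
    proof -
      have "expectation (\<lambda>\<omega>. a \<bullet> z i \<omega>) = 0"
        using mom(3) sqz[of i] by (simp add: square_integrable_integrable)
      then show ?thesis
        using integral_vec_nth(1)[OF mom(2)] by (simp add: z_def inner_diff_right prob_space)
    qed
    \<comment> \<open>\<open>Re p * Re q = Re (p * q + p * cnj q) / 2\<close> with \<open>p = cnj c * R\<close> and \<open>q = cnj a * z i\<close>.\<close>
    have "(c \<bullet> R \<omega>) * (a \<bullet> X \<omega> $ i - a \<bullet> \<mu> $ i) =
        Re ((cnj c * cnj a * (R \<omega> * z i \<omega>) + cnj c * a * (R \<omega> * cnj (z i \<omega>))) / 2)" for \<omega>
      by (simp add: z_def inner_complex_def field_simps)
    then have "expectation (\<lambda>\<omega>. (c \<bullet> R \<omega>) * (a \<bullet> X \<omega> $ i - a \<bullet> \<mu> $ i)) =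
        expectation (\<lambda>\<omega>. Re ((cnj c * cnj a * (R \<omega> * z i \<omega>) + cnj c * a * (R \<omega> * cnj (z i \<omega>))) / 2))"
      by (simp only:)
    also have "\<dots> = 0"
      using iRz iRcz ERz ERcz by (subst integral_Re) simp_all
    finally show "expectation (\<lambda>\<omega>. (c \<bullet> R \<omega>) * (a \<bullet> X \<omega> $ i - expectation (\<lambda>\<omega>. a \<bullet> X \<omega> $ i))) = 0"
      unfolding mean .
    show "real_gaussian M (\<lambda>\<omega>. t * (c \<bullet> R \<omega>) + s * (a \<bullet> X \<omega> $ i))" for t s
    proof -
      define v where "v = t *\<^sub>R (axis j c - axis i (cnj \<kappa> * c)) + s *\<^sub>R axis i a"
      have "t * (c \<bullet> R \<omega>) + s * (a \<bullet> X \<omega> $ i) =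
          (- t * (c \<bullet> \<mu> $ j - (cnj \<kappa> * c) \<bullet> \<mu> $ i)) + v \<bullet> X \<omega>" for \<omega>
        by (simp add: v_def R_def z_def inner_add_left inner_diff_left inner_diff_right inner_axis'
            inner_complex_mult_left algebra_simps)
      then show ?thesis
        by (simp only: real_gaussian_add_const[OF gauss])
    qed
  qed
  have "expectation (\<lambda>\<omega>. R \<omega> * of_real (indicator B (X \<omega> $ i))) = 0"
  proof (rule zero_Fourier_transform_plane[OF iR _ _ B])
    fix a
    have i: "integrable M (\<lambda>\<omega>. (c \<bullet> R \<omega>) *\<^sub>R iexp (a \<bullet> X \<omega> $ i))" for c
      by (rule Bochner_Integration.integrable_bound[of M "\<lambda>\<omega>. c \<bullet> R \<omega>"]) (use iR in auto)
    have "R \<omega> * iexp (a \<bullet> X \<omega> $ i) =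
        (1 \<bullet> R \<omega>) *\<^sub>R iexp (a \<bullet> X \<omega> $ i) + \<i> * ((\<i> \<bullet> R \<omega>) *\<^sub>R iexp (a \<bullet> X \<omega> $ i))" for \<omega>
      by (subst complex_eq[of "R \<omega>"]) (simp add: scaleR_conv_of_real inner_complex_def algebra_simps)
    then show "expectation (\<lambda>\<omega>. R \<omega> * iexp (a \<bullet> X \<omega> $ i)) = 0"
      by (simp only: Bochner_Integration.integral_add[OF i integrable_mult_right[OF i]]
          integral_mult_right_zero part) simp
  qed simp
  then show ?thesis
    by (simp add: R_def z_def \<kappa>_def)
qed

end

section \<open>Unbiased affine estimation of one component\<close>

context prob_space
begin

lemma complex_cond_exp_eqI:
  assumes F: "subalgebra M F" and f: "integrable M f" and g: "integrable M g" "g \<in> borel_measurable F"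
    and eq: "\<And>A. A \<in> sets F \<Longrightarrow> expectation (\<lambda>\<omega>. (f \<omega> - g \<omega>) * of_real (indicator A \<omega>)) = 0"
  shows "AE \<omega> in M. complex_cond_exp M F f \<omega> = g \<omega>"
proof -
  interpret finite_measure_subalgebra M F
    using F by unfold_locales
  have part: "AE \<omega> in M. real_cond_exp M F (\<lambda>\<omega>. T (f \<omega>)) \<omega> = T (g \<omega>)"
    if T: "bounded_linear T" and T_of_real: "\<And>u t. T (u * of_real t) = T u * t"
    for T :: "complex \<Rightarrow> real"
  proof (rule real_cond_exp_charact)
    have Tf: "integrable M (\<lambda>\<omega>. T (f \<omega>))" and Tg: "integrable M (\<lambda>\<omega>. T (g \<omega>))"
      using f g by (auto intro: integrable_bounded_linear[OF T])
    then show "integrable M (\<lambda>\<omega>. T (f \<omega>))" "integrable M (\<lambda>\<omega>. T (g \<omega>))" .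
    show "(\<lambda>\<omega>. T (g \<omega>)) \<in> borel_measurable F"
      using T g(2) by (intro measurable_compose[OF g(2)] borel_measurable_continuous_onI
          linear_continuous_on)
    fix A assume A: "A \<in> sets F"
    then have AM [measurable]: "A \<in> sets M"
      using F by (auto simp: subalgebra_def)
    have int: "integrable M (\<lambda>\<omega>. (f \<omega> - g \<omega>) * of_real (indicator A \<omega>))"
      by (rule Bochner_Integration.integrable_bound[of M "\<lambda>\<omega>. f \<omega> - g \<omega>"])
        (use f g in \<open>auto simp: norm_mult indicator_def\<close>)
    have "0 = T (expectation (\<lambda>\<omega>. (f \<omega> - g \<omega>) * of_real (indicator A \<omega>)))"
      using T by (simp add: eq[OF A] linear_simps)
    also have "\<dots> = expectation (\<lambda>\<omega>. indicator A \<omega> *\<^sub>R T (f \<omega>) - indicator A \<omega> *\<^sub>R T (g \<omega>))"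
      by (subst integral_bounded_linear[OF T int, symmetric])
        (simp add: T_of_real linear_simps[OF T] algebra_simps)
    also have "\<dots> = (LINT \<omega>:A|M. T (f \<omega>)) - (LINT \<omega>:A|M. T (g \<omega>))"
      unfolding set_lebesgue_integral_def
      by (intro Bochner_Integration.integral_diff integrable_mult_indicator AM Tf Tg)
    finally show "(LINT \<omega>:A|M. T (f \<omega>)) = (LINT \<omega>:A|M. T (g \<omega>))"
      by simp
  qed
  have "AE \<omega> in M. real_cond_exp M F (\<lambda>\<omega>. Re (f \<omega>)) \<omega> = Re (g \<omega>)"
    "AE \<omega> in M. real_cond_exp M F (\<lambda>\<omega>. Im (f \<omega>)) \<omega> = Im (g \<omega>)"
    by (auto intro!: part bounded_linear_Re bounded_linear_Im)
  then show ?thesis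
    by eventually_elim (simp add: complex_cond_exp_def)
qed

end

text \<open>All that the estimation of one scalar parameter \<open>\<xi>\<close> of variance \<open>s\<close> requires of its joint law with
  the centred data \<open>w\<close>: \<open>G\<close> is the covariance matrix of the data, \<open>b\<close> their covariance with \<open>\<xi>\<close>, and
  the conditional mean of the data given \<open>\<xi>\<close> is affine in \<open>\<xi>\<close>. The last property is expressed by
  integrals over the events \<open>\<xi> \<in> B\<close>.\<close>

locale regression_model = prob_space M for M :: "'a measure" +
  fixes \<xi> :: "'a \<Rightarrow> complex" and w :: "'m::finite \<Rightarrow> 'a \<Rightarrow> complex"
    and G :: "complex^'m^'m" and b :: "complex^'m" and s :: complex
  assumes sq_\<xi>: "square_integrable M \<xi>" and sq_w: "\<And>k. square_integrable M (w k)"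
    and cov_w: "\<And>k l. expectation (\<lambda>\<omega>. w k \<omega> * cnj (w l \<omega>)) = G $ k $ l"
    and cov_w\<xi>: "\<And>k. expectation (\<lambda>\<omega>. w k \<omega> * cnj (\<xi> \<omega> - expectation \<xi>)) = b $ k"
    and var_\<xi>: "expectation (\<lambda>\<omega>. (\<xi> \<omega> - expectation \<xi>) * cnj (\<xi> \<omega> - expectation \<xi>)) = s"
    and regression: "\<And>k B. B \<in> sets borel \<Longrightarrow>
      expectation (\<lambda>\<omega>. (w k \<omega> - b $ k / s * (\<xi> \<omega> - expectation \<xi>)) * of_real (indicator B (\<xi> \<omega>))) = 0"
    and s: "s \<noteq> 0" and G: "invertible G"
begin

definition comb :: "complex^'m \<Rightarrow> 'a \<Rightarrow> complex" where
  "comb e \<omega> = (\<Sum>k\<in>UNIV. e $ k * w k \<omega>)"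

abbreviation z :: "'a \<Rightarrow> complex" where
  "z \<omega> \<equiv> \<xi> \<omega> - expectation \<xi>"

lemma sq_z: "square_integrable M z"
  using sq_\<xi> by simp

lemma mean_z: "expectation z = 0"
  using sq_\<xi> by (simp add: square_integrable_integrable prob_space)

lemma sq_comb: "square_integrable M (comb e)"
  unfolding comb_def[abs_def] using sq_w by simp

lemma integrable_w_cnj: "square_integrable M f \<Longrightarrow> integrable M (\<lambda>\<omega>. w k \<omega> * cnj (f \<omega>))"
  by (intro square_integrable_mult square_integrable_cnj sq_w)

lemma comb_cov_z: "expectation (\<lambda>\<omega>. comb e \<omega> * cnj (z \<omega>)) = (\<Sum>k\<in>UNIV. e $ k * b $ k)"
proof -
  have "expectation (\<lambda>\<omega>. comb e \<omega> * cnj (z \<omega>)) = expectation (\<lambda>\<omega>. \<Sum>k\<in>UNIV. e $ k * (w k \<omega> * cnj (z \<omega>)))"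
    by (simp add: comb_def sum_distrib_right mult.assoc)
  also have "\<dots> = (\<Sum>k\<in>UNIV. e $ k * b $ k)"
    using integrable_w_cnj[OF sq_z] cov_w\<xi>
    by (subst Bochner_Integration.integral_sum) (auto simp del: complex_cnj_diff)
  finally show ?thesis .
qed

lemma comb_cov_w: "expectation (\<lambda>\<omega>. comb e \<omega> * cnj (w l \<omega>)) = (e v* G) $ l"
proof -
  have "expectation (\<lambda>\<omega>. comb e \<omega> * cnj (w l \<omega>)) = expectation (\<lambda>\<omega>. \<Sum>k\<in>UNIV. e $ k * (w k \<omega> * cnj (w l \<omega>)))"
    by (simp add: comb_def sum_distrib_right mult.assoc)
  also have "\<dots> = (\<Sum>k\<in>UNIV. e $ k * G $ k $ l)"
    using integrable_w_cnj[OF sq_w] cov_w by (subst Bochner_Integration.integral_sum) auto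
  finally show ?thesis
    by (simp add: vector_matrix_mult_def mult.commute)
qed

lemma comb_cov_comb: "expectation (\<lambda>\<omega>. comb e \<omega> * cnj (comb d \<omega>)) = (\<Sum>l\<in>UNIV. cnj (d $ l) * (e v* G) $ l)"
proof -
  have "expectation (\<lambda>\<omega>. comb e \<omega> * cnj (comb d \<omega>)) =
      expectation (\<lambda>\<omega>. \<Sum>l\<in>UNIV. cnj (d $ l) * (comb e \<omega> * cnj (w l \<omega>)))"
    by (simp add: comb_def[of d] sum_distrib_left mult_ac)
  also have "\<dots> = (\<Sum>l\<in>UNIV. cnj (d $ l) * (e v* G) $ l)"
    using square_integrable_mult[OF sq_comb square_integrable_cnj[OF sq_w]]
    by (subst Bochner_Integration.integral_sum) (auto simp: comb_cov_w)
  finally show ?thesis .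
qed

lemma comb_second_moment:
  "complex_of_real (expectation (\<lambda>\<omega>. (cmod (comb e \<omega>))\<^sup>2)) = (\<Sum>l\<in>UNIV. cnj (e $ l) * (e v* G) $ l)"
  unfolding comb_cov_comb[symmetric] by (simp flip: integral_complex_of_real complex_norm_square)

text \<open>The covariance matrix \<open>G\<close> is positive semidefinite by construction; invertibility makes it
  definite. A combination without second moment vanishes almost surely, so it is uncorrelated with
  the data, that is \<open>e v* G = 0\<close>.\<close>

lemma comb_degenerate:
  assumes "expectation (\<lambda>\<omega>. (cmod (comb e \<omega>))\<^sup>2) = 0"
  shows "e = 0"
proof -
  have "AE \<omega> in M. (cmod (comb e \<omega>))\<^sup>2 = 0"
    using assms sq_comb[of e] by (subst (asm) integral_nonneg_eq_0_iff_AE) (auto simp: square_integrable_def)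
  then have ae: "AE \<omega> in M. comb e \<omega> = 0"
    by simp
  have "expectation (\<lambda>\<omega>. comb e \<omega> * cnj (w l \<omega>)) = 0" for l
  proof -
    have "AE \<omega> in M. comb e \<omega> * cnj (w l \<omega>) = 0"
      using ae by eventually_elim simp
    moreover have "integrable M (\<lambda>\<omega>. comb e \<omega> * cnj (w l \<omega>))"
      by (intro square_integrable_mult square_integrable_cnj sq_comb sq_w)
    ultimately show ?thesis
      by (subst integral_cong_AE[where g = "\<lambda>_. 0"]) auto
  qed
  then have eG: "e v* G = 0"
    by (simp add: comb_cov_w vec_eq_iff)
  obtain G' where "G ** G' = mat 1"
    using G by (auto simp: invertible_def)
  then have "e = (e v* G) v* G'"
    by (simp add: vector_matrix_mul_assoc)
  then show ?thesis
    by (simp add: eG)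
qed

text \<open>By the regression property the conditional mean of \<open>comb e + \<beta>\<close> is \<open>\<kappa> / s * z + \<beta>\<close> with
  \<open>\<kappa> = \<Sum>k. e $ k * b $ k\<close>. As \<open>z\<close> is centred with nonzero variance, this is \<open>\<xi>\<close> almost surely only if
  the slope is \<open>1\<close> and the intercept is the mean. Hence conditional unbiasedness is one linear
  equation for \<open>e\<close> and fixes \<open>\<beta>\<close>.\<close>

lemma unbiased_iff:
  "(AE \<omega> in M. complex_cond_exp M (vimage_algebra (space M) \<xi> borel) (\<lambda>\<omega>. comb e \<omega> + \<beta>) \<omega> = \<xi> \<omega>)
    \<longleftrightarrow> (\<Sum>k\<in>UNIV. e $ k * b $ k) = s \<and> \<beta> = expectation \<xi>"
proof -
  let ?F = "vimage_algebra (space M) \<xi> borel"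
  define \<kappa> where "\<kappa> = (\<Sum>k\<in>UNIV. e $ k * b $ k)"
  have [measurable]: "\<xi> \<in> borel_measurable M"
    using sq_\<xi> by measurable
  have F: "subalgebra M ?F"
    unfolding subalgebra_def by (auto simp: sets_vimage_algebra2)
  have ce: "AE \<omega> in M. complex_cond_exp M ?F (\<lambda>\<omega>. comb e \<omega> + \<beta>) \<omega> = \<kappa> / s * z \<omega> + \<beta>"
  proof (rule complex_cond_exp_eqI[OF F])
    show "integrable M (\<lambda>\<omega>. comb e \<omega> + \<beta>)" "integrable M (\<lambda>\<omega>. \<kappa> / s * z \<omega> + \<beta>)"
      by (intro square_integrable_integrable square_integrable_add square_integrable_cmult
          square_integrable_const sq_comb sq_z)+
    have "\<xi> \<in> borel_measurable ?F"
      by (intro measurable_vimage_algebra1) auto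
    then show "(\<lambda>\<omega>. \<kappa> / s * z \<omega> + \<beta>) \<in> borel_measurable ?F"
      by measurable
    fix A assume "A \<in> sets ?F"
    then obtain B where B: "B \<in> sets borel" and A: "A = \<xi> -` B \<inter> space M"
      by (auto simp: sets_vimage_algebra2)
    let ?f = "\<lambda>k \<omega>. (w k \<omega> - b $ k / s * z \<omega>) * of_real (indicator B (\<xi> \<omega>))"
    have int: "integrable M (?f k)" for k
    proof (rule Bochner_Integration.integrable_bound)
      have "square_integrable M (\<lambda>\<omega>. w k \<omega> - b $ k / s * z \<omega>)"
        by (intro square_integrable_diff square_integrable_cmult sq_w sq_z)
      then show "integrable M (\<lambda>\<omega>. w k \<omega> - b $ k / s * z \<omega>)"
        by (rule square_integrable_integrable)
      show "?f k \<in> borel_measurable M"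
        using sq_w[of k] B by measurable
    qed (auto simp: norm_mult indicator_def)
    have "expectation (\<lambda>\<omega>. (comb e \<omega> + \<beta> - (\<kappa> / s * z \<omega> + \<beta>)) * of_real (indicator A \<omega>)) =
        expectation (\<lambda>\<omega>. \<Sum>k\<in>UNIV. e $ k * ?f k \<omega>)"
    proof (rule Bochner_Integration.integral_cong)
      fix \<omega> assume "\<omega> \<in> space M"
      then have "indicator A \<omega> = (indicator B (\<xi> \<omega>) :: real)"
        by (simp add: A indicator_def)
      moreover have "\<kappa> / s * z \<omega> = (\<Sum>k\<in>UNIV. e $ k * (b $ k / s * z \<omega>))"
        by (simp add: \<kappa>_def sum_divide_distrib sum_distrib_right mult.assoc)
      then have "comb e \<omega> + \<beta> - (\<kappa> / s * z \<omega> + \<beta>) = (\<Sum>k\<in>UNIV. e $ k * (w k \<omega> - b $ k / s * z \<omega>))"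
        by (simp add: comb_def right_diff_distrib sum_subtractf)
      ultimately show "(comb e \<omega> + \<beta> - (\<kappa> / s * z \<omega> + \<beta>)) * of_real (indicator A \<omega>) = (\<Sum>k\<in>UNIV. e $ k * ?f k \<omega>)"
        by (simp only: sum_distrib_right mult.assoc)
    qed simp
    also have "\<dots> = (\<Sum>k\<in>UNIV. e $ k * expectation (?f k))"
      using int by (subst Bochner_Integration.integral_sum) auto
    also have "\<dots> = 0"
      by (simp only: regression[OF B] mult_zero_right sum.neutral_const)
    finally show "expectation (\<lambda>\<omega>. (comb e \<omega> + \<beta> - (\<kappa> / s * z \<omega> + \<beta>)) * of_real (indicator A \<omega>)) = 0" .
  qed
  show ?thesis
    unfolding \<kappa>_def[symmetric]
  proof
    assume "AE \<omega> in M. complex_cond_exp M ?F (\<lambda>\<omega>. comb e \<omega> + \<beta>) \<omega> = \<xi> \<omega>"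
    with ce have ae: "AE \<omega> in M. (\<kappa> / s - 1) * z \<omega> + (\<beta> - expectation \<xi>) = 0"
      by eventually_elim (simp add: algebra_simps)
    have iz: "integrable M z"
      by (rule square_integrable_integrable[OF sq_z])
    have "expectation (\<lambda>\<omega>. (\<kappa> / s - 1) * z \<omega> + (\<beta> - expectation \<xi>)) = 0"
      using ae by (subst integral_cong_AE[where g = "\<lambda>_. 0"]) auto
    moreover have "expectation (\<lambda>\<omega>. (\<kappa> / s - 1) * z \<omega> + (\<beta> - expectation \<xi>)) =
        (\<kappa> / s - 1) * expectation z + (\<beta> - expectation \<xi>)"
      by (subst Bochner_Integration.integral_add)
        (use iz in \<open>simp_all only: integral_mult_right_zero integrable_mult_right lebesgue_integral_const
          prob_space scaleR_one integrable_const\<close>)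
    ultimately have \<beta>: "\<beta> = expectation \<xi>"
      by (simp only: mean_z) simp
    \<comment> \<open>The slope: test the almost sure equation against \<open>cnj z\<close>.\<close>
    have "expectation (\<lambda>\<omega>. (\<kappa> / s - 1) * (z \<omega> * cnj (z \<omega>))) = 0"
    proof -
      have "AE \<omega> in M. (\<kappa> / s - 1) * (z \<omega> * cnj (z \<omega>)) = 0"
        using ae by eventually_elim (auto simp: \<beta>)
      moreover have "integrable M (\<lambda>\<omega>. (\<kappa> / s - 1) * (z \<omega> * cnj (z \<omega>)))"
        by (intro integrable_mult_right square_integrable_mult square_integrable_cnj sq_z)
      ultimately show ?thesis
        by (subst integral_cong_AE[where g = "\<lambda>_. 0"]) (auto simp del: complex_cnj_diff)
    qed
    then have "(\<kappa> / s - 1) * s = 0"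
      by (simp only: integral_mult_right_zero var_\<xi>)
    then show "\<kappa> = s \<and> \<beta> = expectation \<xi>"
      using s \<beta> by simp
  next
    assume "\<kappa> = s \<and> \<beta> = expectation \<xi>"
    with ce s show "AE \<omega> in M. complex_cond_exp M ?F (\<lambda>\<omega>. comb e \<omega> + \<beta>) \<omega> = \<xi> \<omega>"
      by simp
  qed
qed

text \<open>In matrix notation \<open>r = b\<^sup>H G\<^sup>-\<^sup>1\<close> and \<open>q = b\<^sup>H G\<^sup>-\<^sup>1 b\<close>: \<open>r\<close> is the coefficient row
  of the linear minimum mean square error estimator of \<open>\<xi>\<close> without the constraint.\<close>

context
  fixes r :: "complex^'m" and q :: complex
  assumes r: "\<And>l. (r v* G) $ l = cnj (b $ l)" and q: "q = (\<Sum>k\<in>UNIV. r $ k * b $ k)"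
begin

text \<open>The reason is \<open>E \<bar>comb r\<bar>\<^sup>2 = cnj q\<close>, which is positive unless \<open>r = 0\<close>, and \<open>r = 0\<close>
  forces \<open>b = 0\<close>.\<close>

lemma quadratic_form_real: "q \<in> \<real>"
  and quadratic_form_nonzero: "b \<noteq> 0 \<Longrightarrow> q \<noteq> 0"
proof -
  have eq: "complex_of_real (expectation (\<lambda>\<omega>. (cmod (comb r \<omega>))\<^sup>2)) = cnj q"
    by (simp add: comb_second_moment r q)
  then show "q \<in> \<real>"
    by (metis Reals_cnj_iff Reals_of_real complex_cnj_cnj)
  show "q \<noteq> 0" if "b \<noteq> 0"
  proof
    assume "q = 0"
    with eq have "r = 0"
      by (intro comb_degenerate) simp
    then have "cnj (b $ l) = 0" for l
      using r[of l] by simp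
    then have "b = 0"
      by (simp add: vec_eq_iff)
    with that show False by simp
  qed
qed

text \<open>Pythagoras: two solutions of the constraint differ by some \<open>d\<close> with \<open>\<Sum>k. d $ k * b $ k = 0\<close>, so
  \<open>comb d\<close> is orthogonal to \<open>z\<close>. It is also orthogonal to \<open>comb e0\<close>, because \<open>e0 v* G\<close> is a multiple
  of the conjugate of \<open>b\<close>. The factor \<open>s / q\<close> makes \<open>e0\<close> itself a solution.\<close>

lemma constrained_error_decomposition:
  assumes e0: "e0 = (s / q) *s r" and "q \<noteq> 0" and e: "(\<Sum>k\<in>UNIV. e $ k * b $ k) = s"
  shows "expectation (\<lambda>\<omega>. (cmod (comb e \<omega> - z \<omega>))\<^sup>2) =
    expectation (\<lambda>\<omega>. (cmod (comb e0 \<omega> - z \<omega>))\<^sup>2) + expectation (\<lambda>\<omega>. (cmod (comb (e - e0) \<omega>))\<^sup>2)"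
proof -
  define d where "d = e - e0"
  have e0b: "(\<Sum>k\<in>UNIV. e0 $ k * b $ k) = s"
  proof -
    have "(\<Sum>k\<in>UNIV. e0 $ k * b $ k) = s / q * (\<Sum>k\<in>UNIV. r $ k * b $ k)"
      by (simp add: e0 sum_distrib_left mult.assoc)
    then show ?thesis
      using \<open>q \<noteq> 0\<close> by (simp flip: q)
  qed
  have db: "(\<Sum>k\<in>UNIV. d $ k * b $ k) = 0"
    using e e0b by (simp add: d_def left_diff_distrib sum_subtractf)
  have sq0: "square_integrable M (\<lambda>\<omega>. comb e0 \<omega> - z \<omega>)"
    by (intro square_integrable_diff sq_comb sq_z)
  have e0G: "(e0 v* G) $ l = s / q * cnj (b $ l)" for l
    by (simp add: e0 vector_matrix_mult_def r[symmetric] sum_distrib_left mult_ac)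
  have "expectation (\<lambda>\<omega>. comb e0 \<omega> * cnj (comb d \<omega>)) = s / q * cnj (\<Sum>k\<in>UNIV. d $ k * b $ k)"
    by (simp add: comb_cov_comb e0G sum_distrib_left mult_ac)
  moreover have "expectation (\<lambda>\<omega>. z \<omega> * cnj (comb d \<omega>)) = cnj (expectation (\<lambda>\<omega>. comb d \<omega> * cnj (z \<omega>)))"
    by (simp add: mult.commute flip: Bochner_Integration.integral_cnj)
  moreover have i1: "integrable M (\<lambda>\<omega>. comb e0 \<omega> * cnj (comb d \<omega>))"
    and i2: "integrable M (\<lambda>\<omega>. z \<omega> * cnj (comb d \<omega>))"
    by (intro square_integrable_mult square_integrable_cnj sq_comb sq_z)+
  ultimately have cross: "expectation (\<lambda>\<omega>. (comb e0 \<omega> - z \<omega>) * cnj (comb d \<omega>)) = 0"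
    unfolding left_diff_distrib[of "comb e0 _"]
    by (simp only: Bochner_Integration.integral_diff[OF i1 i2] comb_cov_z db complex_cnj_zero
        mult_zero_right diff_self)
  have "comb e \<omega> = comb e0 \<omega> + comb d \<omega>" for \<omega>
    by (simp add: comb_def d_def algebra_simps flip: sum.distrib)
  then have "(cmod (comb e \<omega> - z \<omega>))\<^sup>2 =
      (cmod (comb e0 \<omega> - z \<omega>))\<^sup>2 + (cmod (comb d \<omega>))\<^sup>2 + 2 * Re ((comb e0 \<omega> - z \<omega>) * cnj (comb d \<omega>))" for \<omega>
    by (simp add: cmod_power2) (simp add: power2_eq_square algebra_simps)
  moreover have "expectation (\<lambda>\<omega>. (cmod (comb e0 \<omega> - z \<omega>))\<^sup>2 + (cmod (comb d \<omega>))\<^sup>2 + 2 * Re ((comb e0 \<omega> - z \<omega>) * cnj (comb d \<omega>)))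
     = expectation (\<lambda>\<omega>. (cmod (comb e0 \<omega> - z \<omega>))\<^sup>2) + expectation (\<lambda>\<omega>. (cmod (comb d \<omega>))\<^sup>2)
      + 2 * Re (expectation (\<lambda>\<omega>. (comb e0 \<omega> - z \<omega>) * cnj (comb d \<omega>)))"
  proof -
    have "integrable M (\<lambda>\<omega>. (comb e0 \<omega> - z \<omega>) * cnj (comb d \<omega>))"
      by (intro square_integrable_mult square_integrable_cnj sq_comb sq0)
    then have "has_bochner_integral M (\<lambda>\<omega>. (comb e0 \<omega> - z \<omega>) * cnj (comb d \<omega>))
        (expectation (\<lambda>\<omega>. (comb e0 \<omega> - z \<omega>) * cnj (comb d \<omega>)))"
      by (rule has_bochner_integral_integrable)
    moreover have "has_bochner_integral M (\<lambda>\<omega>. (cmod (comb e0 \<omega> - z \<omega>))\<^sup>2) (expectation (\<lambda>\<omega>. (cmod (comb e0 \<omega> - z \<omega>))\<^sup>2))"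
      "has_bochner_integral M (\<lambda>\<omega>. (cmod (comb d \<omega>))\<^sup>2) (expectation (\<lambda>\<omega>. (cmod (comb d \<omega>))\<^sup>2))"
      using sq0 sq_comb[of d] by (auto intro!: has_bochner_integral_integrable simp: square_integrable_def)
    ultimately show ?thesis
      by (intro has_bochner_integral_integral_eq has_bochner_integral_add has_bochner_integral_mult_right
          has_bochner_integral_Re) auto
  qed
  ultimately show ?thesis
    using cross by (simp add: d_def del: complex_cnj_diff Re_complex_of_real)
qed

end

end

section \<open>The linear model with Gaussian parameter\<close>

lemma matrix_inv_right_left:
  fixes A :: "'a::semiring_1^'n^'n"
  assumes "invertible A"
  shows "A ** matrix_inv A = mat 1" "matrix_inv A ** A = mat 1"
  using someI_ex[OF assms[unfolded invertible_def]] by (auto simp: matrix_inv_def)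

context prob_space
begin

text \<open>The two vectors may take values in different spaces; only the scalar functions of them need to
  have a common type for the product formula of independent random variables.\<close>

lemma indep_vimage_expectation_mult:
  fixes x :: "'a \<Rightarrow> 'b::topological_space" and n :: "'a \<Rightarrow> 'c::topological_space"
    and f :: "'b \<Rightarrow> complex" and g :: "'c \<Rightarrow> complex"
  assumes indep: "indep_set (sets (vimage_algebra (space M) x borel)) (sets (vimage_algebra (space M) n borel))"
    and "f \<in> borel_measurable borel" "g \<in> borel_measurable borel"
    and "integrable M (\<lambda>\<omega>. f (x \<omega>))" "integrable M (\<lambda>\<omega>. g (n \<omega>))"
  shows "expectation (\<lambda>\<omega>. f (x \<omega>) * g (n \<omega>)) = expectation (\<lambda>\<omega>. f (x \<omega>)) * expectation (\<lambda>\<omega>. g (n \<omega>))"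
proof -
  have sub: "sets (vimage_algebra (space M) (\<lambda>\<omega>. h (v \<omega>)) borel) \<subseteq> sets (vimage_algebra (space M) v borel)"
    if h: "h \<in> borel_measurable borel" for v :: "'a \<Rightarrow> 'd::topological_space" and h :: "'d \<Rightarrow> complex"
  proof
    fix A assume "A \<in> sets (vimage_algebra (space M) (\<lambda>\<omega>. h (v \<omega>)) borel)"
    then obtain B where B: "B \<in> sets borel" "A = (\<lambda>\<omega>. h (v \<omega>)) -` B \<inter> space M"
      by (auto simp: sets_vimage_algebra2)
    then have "A = v -` (h -` B) \<inter> space M" "h -` B \<in> sets borel"
      using measurable_sets[OF h, of B] by auto
    then show "A \<in> sets (vimage_algebra (space M) v borel)"
      by (simp add: in_vimage_algebra)
  qed
  have [measurable]: "(\<lambda>\<omega>. f (x \<omega>)) \<in> borel_measurable M" "(\<lambda>\<omega>. g (n \<omega>)) \<in> borel_measurable M"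
    using assms(4,5) by auto
  have "indep_set (sets (vimage_algebra (space M) (\<lambda>\<omega>. f (x \<omega>)) borel))
      (sets (vimage_algebra (space M) (\<lambda>\<omega>. g (n \<omega>)) borel))"
    using indep sub[OF assms(2), of x] sub[OF assms(3), of n] unfolding indep_sets2_eq by blast
  then have "indep_var borel (\<lambda>\<omega>. f (x \<omega>)) borel (\<lambda>\<omega>. g (n \<omega>))"
    by (simp add: indep_var_eq sets_vimage_algebra)
  then show ?thesis
    using assms(4,5) by (rule indep_var_lebesgue_integral)
qed

text \<open>The centred data are \<open>H z + n\<close> with \<open>z\<close> the centred parameter. Their noise part is uncorrelated with
  \<open>z\<close> and has mean \<open>0\<close> on every event \<open>x\<^sub>i \<in> B\<close> by independence, whatever its distribution; so their
  covariances and their regression on \<open>x\<^sub>i\<close> come from those of \<open>z\<close>, where Gaussianity enters.\<close>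

lemma linear_gaussian_regression_model:
  fixes x :: "'a \<Rightarrow> complex^'n" and noise y :: "'a \<Rightarrow> complex^'m"
    and H :: "complex^'n^'m" and Cxx :: "complex^'n^'n" and Cnn :: "complex^'m^'m"
  assumes y: "\<And>\<omega>. y \<omega> = H *v x \<omega> + noise \<omega>"
    and X: "proper_complex_gaussian M x (expectation x) Cxx"
    and noise_meas: "noise \<in> borel_measurable M"
    and noise_sq: "integrable M (\<lambda>\<omega>. (norm (noise \<omega>))\<^sup>2)"
    and noise_mean: "expectation noise = 0"
    and noise_cov: "cov_matrix M noise noise = Cnn"
    and indep: "indep_set (sets (vimage_algebra (space M) x borel))
           (sets (vimage_algebra (space M) noise borel))"
    and inv: "invertible (H ** Cxx ** H\<^sup>H + Cnn)"
    and var: "Re (Cxx $ i $ i) > 0"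
  shows "regression_model M (\<lambda>\<omega>. x \<omega> $ i) (\<lambda>k \<omega>. (y \<omega> - expectation y) $ k)
    (H ** Cxx ** H\<^sup>H + Cnn) (H *v column i Cxx) (Cxx $ i $ i)"
    and "expectation (\<lambda>\<omega>. x \<omega> $ i) = expectation x $ i"
proof -
  define \<mu> where "\<mu> = expectation x"
  define z where "z j \<omega> = (x \<omega> - \<mu>) $ j" for j \<omega>
  define u where "u k \<omega> = noise \<omega> $ k" for k \<omega>
  have [measurable]: "x \<in> borel_measurable M"
    using X by (simp add: proper_complex_gaussian_def)
  note [measurable] = noise_meas
  note mom = proper_complex_gaussian_moments[OF X, folded \<mu>_def, folded z_def]
  have sqz: "square_integrable M (z j)" for j
    using mom(1) by (simp add: z_def[abs_def])
  have squ: "square_integrable M (u k)" for k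
    unfolding square_integrable_def
  proof
    show "u k \<in> borel_measurable M"
      by (simp add: u_def[abs_def])
    then show "integrable M (\<lambda>\<omega>. (cmod (u k \<omega>))\<^sup>2)"
      using Finite_Cartesian_Product.norm_nth_le
      by (intro Bochner_Integration.integrable_bound[OF noise_sq]) (auto simp: u_def power_mono)
  qed
  have int_noise: "integrable M noise"
    using squ by (intro integrable_vec square_integrable_integrable) (auto simp: u_def[abs_def])
  have mu: "expectation (u k) = 0" for k
    using integral_vec_nth(2)[OF int_noise, of k] noise_mean by (simp add: u_def[abs_def])
  have iz: "integrable M (z j)" and iu: "integrable M (u k)" for j k
    using sqz squ by (auto intro: square_integrable_integrable)
  have ind: "expectation (\<lambda>\<omega>. f (x \<omega>) * u k \<omega>) = 0" "expectation (\<lambda>\<omega>. f (x \<omega>) * cnj (u k \<omega>)) = 0"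
    if "f \<in> borel_measurable borel" "integrable M (\<lambda>\<omega>. f (x \<omega>))" for f k
  proof -
    have [measurable]: "cnj \<in> borel_measurable borel"
      by (intro borel_measurable_continuous_onI continuous_intros)
    show "expectation (\<lambda>\<omega>. f (x \<omega>) * u k \<omega>) = 0"
      using indep_vimage_expectation_mult[OF indep that(1) _ that(2), of "\<lambda>v. v $ k"]
        iu[of k] mu[of k] by (simp add: u_def[abs_def])
    show "expectation (\<lambda>\<omega>. f (x \<omega>) * cnj (u k \<omega>)) = 0"
      using indep_vimage_expectation_mult[OF indep that(1) _ that(2), of "\<lambda>v. cnj (v $ k)"]
        iu[of k] mu[of k] by (simp add: u_def[abs_def])
  qed
  have zu: "expectation (\<lambda>\<omega>. z j \<omega> * cnj (u k \<omega>)) = 0" for j k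
    using ind(2)[of "\<lambda>v. (v - \<mu>) $ j"] iz[of j] by (simp add: z_def[abs_def])
  have uz: "expectation (\<lambda>\<omega>. u k \<omega> * cnj (z j \<omega>)) = 0" for j k
  proof -
    have "expectation (\<lambda>\<omega>. u k \<omega> * cnj (z j \<omega>)) = cnj (expectation (\<lambda>\<omega>. z j \<omega> * cnj (u k \<omega>)))"
      by (simp add: mult.commute flip: Bochner_Integration.integral_cnj)
    then show ?thesis
      by (simp add: zu)
  qed
  have uu: "expectation (\<lambda>\<omega>. u k \<omega> * cnj (u l \<omega>)) = Cnn $ k $ l" for k l
    using noise_cov noise_mean by (auto simp: cov_matrix_def u_def)
  have int_Hx: "integrable M (\<lambda>\<omega>. H *v x \<omega>)"
    using mom(2) integrable_bounded_linear[OF matrix_vector_mul_bounded_linear[of H]] by blast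
  have Ey: "expectation y = H *v \<mu>"
    unfolding y \<mu>_def using int_Hx int_noise noise_mean
      integral_bounded_linear[OF matrix_vector_mul_bounded_linear[of H] mom(2)] by simp
  have w: "(y \<omega> - expectation y) $ k = (\<Sum>j\<in>UNIV. H $ k $ j * z j \<omega>) + u k \<omega>" for k \<omega>
    by (simp add: Ey y z_def u_def matrix_vector_mult_def right_diff_distrib sum_subtractf)
  show mean_xi: "expectation (\<lambda>\<omega>. x \<omega> $ i) = expectation x $ i"
    using integral_vec_nth(2)[OF mom(2)] by simp
  then have zi: "x \<omega> $ i - expectation (\<lambda>\<omega>. x \<omega> $ i) = z i \<omega>" for \<omega>
    by (simp add: z_def \<mu>_def)
  have col: "(H *v column i Cxx) $ k = (\<Sum>j\<in>UNIV. H $ k $ j * Cxx $ j $ i)" for k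
    by (simp add: matrix_vector_mult_def column_def)
  have sqw: "square_integrable M (\<lambda>\<omega>. (\<Sum>j\<in>UNIV. H $ k $ j * z j \<omega>) + u k \<omega>)" for k
    using sqz squ by simp
  have wz: "expectation (\<lambda>\<omega>. ((\<Sum>j\<in>UNIV. H $ k $ j * z j \<omega>) + u k \<omega>) * cnj (z l \<omega>)) =
      (\<Sum>j\<in>UNIV. H $ k $ j * Cxx $ j $ l)" for k l
  proof -
    have "expectation (\<lambda>\<omega>. ((\<Sum>j\<in>UNIV. H $ k $ j * z j \<omega>) + u k \<omega>) * cnj (z l \<omega>)) =
        expectation (\<lambda>\<omega>. (\<Sum>j\<in>UNIV. H $ k $ j * (z j \<omega> * cnj (z l \<omega>))) + u k \<omega> * cnj (z l \<omega>))"
      by (simp add: distrib_right sum_distrib_right mult.assoc)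
    also have "\<dots> = (\<Sum>j\<in>UNIV. H $ k $ j * Cxx $ j $ l)"
      using sqz squ by (simp add: square_integrable_mult mom(4) uz)
    finally show ?thesis .
  qed
  have wu: "expectation (\<lambda>\<omega>. ((\<Sum>j\<in>UNIV. H $ k $ j * z j \<omega>) + u k \<omega>) * cnj (u l \<omega>)) = Cnn $ k $ l" for k l
  proof -
    have "expectation (\<lambda>\<omega>. ((\<Sum>j\<in>UNIV. H $ k $ j * z j \<omega>) + u k \<omega>) * cnj (u l \<omega>)) =
        expectation (\<lambda>\<omega>. (\<Sum>j\<in>UNIV. H $ k $ j * (z j \<omega> * cnj (u l \<omega>))) + u k \<omega> * cnj (u l \<omega>))"
      by (simp add: distrib_right sum_distrib_right mult.assoc)
    also have "\<dots> = Cnn $ k $ l"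
      using sqz squ by (simp add: square_integrable_mult zu uu)
    finally show ?thesis .
  qed
  show "regression_model M (\<lambda>\<omega>. x \<omega> $ i) (\<lambda>k \<omega>. (y \<omega> - expectation y) $ k)
    (H ** Cxx ** H\<^sup>H + Cnn) (H *v column i Cxx) (Cxx $ i $ i)"
  proof (unfold_locales, unfold w zi)
    have "square_integrable M (\<lambda>\<omega>. z i \<omega> + \<mu> $ i)"
      using sqz by simp
    then show "square_integrable M (\<lambda>\<omega>. x \<omega> $ i)"
      by (simp add: z_def)
    show "square_integrable M (\<lambda>\<omega>. (\<Sum>j\<in>UNIV. H $ k $ j * z j \<omega>) + u k \<omega>)" for k
      by (rule sqw)
    show "expectation (\<lambda>\<omega>. ((\<Sum>j\<in>UNIV. H $ k $ j * z j \<omega>) + u k \<omega>) *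
        cnj ((\<Sum>j\<in>UNIV. H $ l $ j * z j \<omega>) + u l \<omega>)) = (H ** Cxx ** H\<^sup>H + Cnn) $ k $ l" for k l
    proof -
      let ?w = "\<lambda>\<omega>. (\<Sum>j\<in>UNIV. H $ k $ j * z j \<omega>) + u k \<omega>"
      have "expectation (\<lambda>\<omega>. ?w \<omega> * cnj ((\<Sum>j\<in>UNIV. H $ l $ j * z j \<omega>) + u l \<omega>)) =
          expectation (\<lambda>\<omega>. (\<Sum>j\<in>UNIV. cnj (H $ l $ j) * (?w \<omega> * cnj (z j \<omega>))) + ?w \<omega> * cnj (u l \<omega>))"
        by (simp only: complex_cnj_add cnj_sum complex_cnj_mult distrib_left[of "?w _"] sum_distrib_left mult.left_commute)
      also have "\<dots> = (\<Sum>j\<in>UNIV. cnj (H $ l $ j) * expectation (\<lambda>\<omega>. ?w \<omega> * cnj (z j \<omega>))) + expectation (\<lambda>\<omega>. ?w \<omega> * cnj (u l \<omega>))"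
        using square_integrable_mult[OF sqw square_integrable_cnj[OF sqz]]
          square_integrable_mult[OF sqw square_integrable_cnj[OF squ]]
        by (subst Bochner_Integration.integral_add, simp_all only: integrable_mult_right
            Bochner_Integration.integrable_sum Bochner_Integration.integral_sum integral_mult_right_zero)
      also have "\<dots> = (H ** Cxx ** H\<^sup>H + Cnn) $ k $ l"
        unfolding wz wu by (simp add: matrix_matrix_mult_def adjoint_matrix_def mult.commute)
      finally show ?thesis .
    qed
    show "expectation (\<lambda>\<omega>. ((\<Sum>j\<in>UNIV. H $ k $ j * z j \<omega>) + u k \<omega>) * cnj (z i \<omega>)) = (H *v column i Cxx) $ k" for k
      unfolding wz col ..
    show "expectation (\<lambda>\<omega>. z i \<omega> * cnj (z i \<omega>)) = Cxx $ i $ i"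
      by (rule mom(4))
    show Cii: "Cxx $ i $ i \<noteq> 0"
      using var by auto
    show "invertible (H ** Cxx ** H\<^sup>H + Cnn)"
      by (rule inv)
    fix k and B :: "complex set"
    assume B [measurable]: "B \<in> sets borel"
    let ?R = "\<lambda>j \<omega>. (z j \<omega> - Cxx $ j $ i / Cxx $ i $ i * z i \<omega>) * of_real (indicator B (x \<omega> $ i))"
    have cut: "integrable M (\<lambda>\<omega>. f \<omega> * of_real (indicator B (x \<omega> $ i)))" if "square_integrable M f" for f
      by (rule Bochner_Integration.integrable_bound[OF square_integrable_integrable[OF that]])
        (use that in \<open>auto simp: norm_mult indicator_def\<close>)
    have iR: "integrable M (?R j)" for j
      by (intro cut square_integrable_diff square_integrable_cmult sqz)
    have R0: "expectation (?R j) = 0" for j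
      unfolding z_def \<mu>_def by (rule proper_gaussian_regression[OF X Cii B])
    have u0: "expectation (\<lambda>\<omega>. u k \<omega> * of_real (indicator B (x \<omega> $ i))) = 0"
    proof -
      have "integrable M (\<lambda>\<omega>. complex_of_real (indicator B (x \<omega> $ i)))"
        using cut[of "\<lambda>_. 1"] by simp
      then show ?thesis
        using ind(1)[of "\<lambda>v. of_real (indicator B (v $ i))" k] by (simp add: mult.commute)
    qed
    have "((\<Sum>j\<in>UNIV. H $ k $ j * z j \<omega>) + u k \<omega> - (H *v column i Cxx) $ k / Cxx $ i $ i * z i \<omega>) *
        of_real (indicator B (x \<omega> $ i)) =
        (\<Sum>j\<in>UNIV. H $ k $ j * ?R j \<omega>) + u k \<omega> * of_real (indicator B (x \<omega> $ i))" for \<omega>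
      unfolding col by (simp add: sum_distrib_left sum_distrib_right sum_divide_distrib sum_subtractf algebra_simps)
    then show "expectation (\<lambda>\<omega>. ((\<Sum>j\<in>UNIV. H $ k $ j * z j \<omega>) + u k \<omega> -
        (H *v column i Cxx) $ k / Cxx $ i $ i * z i \<omega>) * of_real (indicator B (x \<omega> $ i))) = 0"
      using iR cut[OF squ] R0 u0
      by (simp only:) (subst Bochner_Integration.integral_add, simp_all only: integrable_mult_right
            Bochner_Integration.integrable_sum Bochner_Integration.integral_sum integral_mult_right_zero
            mult_zero_right sum.neutral_const add_0_left)
  qed
qed

end

lemma row_matrix_mult: "(A ** B) $ i = (A $ i) v* B" for A :: "'a::comm_semiring_1^'n^'m"
  by (simp add: vec_eq_iff matrix_matrix_mult_def vector_matrix_mult_def mult.commute)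

lemma scale_vector_matrix_mult: "(c *s v) v* A = c *s (v v* A)" for c :: "'a::comm_semiring_1"
  by (simp add: vec_eq_iff vector_matrix_mult_def sum_distrib_left mult_ac)

lemma cov_matrix_hermitian: "cov_matrix M u v $ i $ j = cnj (cov_matrix M v u $ j $ i)"
  unfolding cov_matrix_def
  by (simp add: mult.commute flip: Bochner_Integration.integral_cnj)

theorem proposition2:
  fixes M :: "'a measure"
    and x :: "'a \<Rightarrow> complex^'n" and noise y :: "'a \<Rightarrow> complex^'m"
    and H :: "complex^'n^'m" and Cxx :: "complex^'n^'n" and Cnn :: "complex^'m^'m"
    and quad :: "'n \<Rightarrow> complex" and D :: "complex^'n^'n" and E_CL :: "complex^'m^'n"
  assumes "prob_space M"
    and "\<And>\<omega>. y \<omega> = H *v x \<omega> + noise \<omega>"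
    and "proper_complex_gaussian M x (\<integral>\<omega>. x \<omega> \<partial>M) Cxx"
    and "noise \<in> borel_measurable M"
    and "integrable M (\<lambda>\<omega>. (norm (noise \<omega>))\<^sup>2)"
    and "(\<integral>\<omega>. noise \<omega> \<partial>M) = 0"
    and "cov_matrix M noise noise = Cnn"
    and "prob_space.indep_set M (sets (vimage_algebra (space M) x borel))
           (sets (vimage_algebra (space M) noise borel))"
    and "invertible (H ** Cxx ** H\<^sup>H + Cnn)"
    and "\<And>i. Re (Cxx $ i $ i) > 0"
    and "\<And>i. H *v column i Cxx \<noteq> 0"
    and quad_eq: "\<And>i. quad i =
           ((rowvector (row i Cxx) :: complex^'n^1) ** H\<^sup>H ** matrix_inv (H ** Cxx ** H\<^sup>H + Cnn)
              ** H ** (columnvector (column i Cxx) :: complex^1^'n)) $ 1 $ 1"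
    and D_eq: "D = (\<chi> i j. if i = j then Cxx $ i $ i / quad i else 0)"
    and E_CL_eq: "E_CL = D ** Cxx ** H\<^sup>H ** matrix_inv (H ** Cxx ** H\<^sup>H + Cnn)"
  shows "(\<forall>i. quad i \<noteq> 0 \<and> D $ i $ i \<in> \<real>) \<and>
         (\<forall>g. is_CWCU_LMMSE M x y g \<longleftrightarrow>
              g = (\<lambda>v. (\<integral>\<omega>. x \<omega> \<partial>M) + E_CL *v (v - (\<integral>\<omega>. y \<omega> \<partial>M))))"
proof -
  interpret prob_space M by (rule assms(1))
  define G where "G = H ** Cxx ** H\<^sup>H + Cnn"
  define \<mu> where "\<mu> = expectation x"
  define b where "b i = H *v column i Cxx" for i
  define r where "r i = (Cxx $ i v* H\<^sup>H) v* matrix_inv G" for i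
  define g\<^sub>0 where "g\<^sub>0 = (\<lambda>v. \<mu> + E_CL *v (v - expectation y))"
  have invG: "matrix_inv G ** G = mat 1"
    using matrix_inv_right_left(2)[OF assms(9)] by (simp add: G_def)
  have model: "regression_model M (\<lambda>\<omega>. x \<omega> $ i) (\<lambda>k \<omega>. (y \<omega> - expectation y) $ k) G (b i) (Cxx $ i $ i)"
    and mean_xi: "expectation (\<lambda>\<omega>. x \<omega> $ i) = \<mu> $ i" for i
    unfolding G_def b_def \<mu>_def
    using linear_gaussian_regression_model[OF assms(2,3,4,5,6,7,8,9) assms(10)[of i]] by blast+
  have hermitian: "Cxx $ i $ j = cnj (Cxx $ j $ i)" for i j
    using assms(3) cov_matrix_hermitian[of M x x i j] by (simp add: proper_complex_gaussian_def)
  have rG: "(r i v* G) $ l = cnj (b i $ l)" for i l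
  proof -
    have "r i v* G = Cxx $ i v* H\<^sup>H"
      unfolding r_def by (simp add: vector_matrix_mul_assoc invG flip: matrix_mul_assoc)
    then show ?thesis
      by (simp add: vector_matrix_mult_def adjoint_matrix_def b_def matrix_vector_mult_def column_def
          hermitian[of i] mult.commute)
  qed
  have quad: "quad i = (\<Sum>k\<in>UNIV. r i $ k * b i $ k)" for i
  proof -
    have "rowvector (row i Cxx) $ (1::1) = Cxx $ i"
      by (simp add: rowvector_def row_def)
    then have "((rowvector (row i Cxx) :: complex^'n^1) ** H\<^sup>H ** matrix_inv G) $ 1 = r i"
      by (simp add: row_matrix_mult r_def)
    moreover have "quad i = (((rowvector (row i Cxx) :: complex^'n^1) ** H\<^sup>H ** matrix_inv G) **
        (columnvector (b i) :: complex^1^'m)) $ 1 $ 1"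
      unfolding quad_eq b_def dot_rowvector_columnvector G_def by (simp add: matrix_mul_assoc)
    moreover have "(A ** (columnvector v :: complex^1^'m)) $ 1 $ 1 = (\<Sum>k\<in>UNIV. A $ 1 $ k * v $ k)"
      for A :: "complex^'m^1" and v
      by (simp add: matrix_matrix_mult_def columnvector_def)
    ultimately show ?thesis
      by (simp only:)
  qed
  have quad_real: "quad i \<in> \<real>" and quad_nz: "quad i \<noteq> 0" for i
    using regression_model.quadratic_form_real[OF model rG quad]
      regression_model.quadratic_form_nonzero[OF model rG quad] assms(11) by (auto simp: b_def)
  have E_row: "E_CL $ i = (Cxx $ i $ i / quad i) *s r i" for i
  proof -
    have "D $ i v* Cxx = (Cxx $ i $ i / quad i) *s Cxx $ i"
      by (simp add: D_eq vec_eq_iff vector_matrix_mult_def if_distrib[of "\<lambda>t. _ * t"] mult.commute cong: if_cong)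
    then show ?thesis
      unfolding E_CL_eq r_def G_def by (simp add: row_matrix_mult scale_vector_matrix_mult)
  qed
  have D_real: "D $ i $ i \<in> \<real>" for i
  proof -
    have "Cxx $ i $ i \<in> \<real>"
      using hermitian[of i i] by (simp add: Reals_cnj_iff)
    then show ?thesis
      using quad_real by (simp add: D_eq)
  qed
  have estimate: "(E *v y \<omega> + c) $ i =
      regression_model.comb (\<lambda>k \<omega>. (y \<omega> - expectation y) $ k) (E $ i) \<omega> + (E *v expectation y + c) $ i"
    for E :: "complex^'m^'n" and c i \<omega>
    unfolding regression_model.comb_def[OF model]
    by (simp add: matrix_vector_mult_def right_diff_distrib sum_subtractf)
  have unbiased: "cond_unbiased M x y (\<lambda>v. E *v v + c) i \<longleftrightarrow>
      (\<Sum>k\<in>UNIV. E $ i $ k * b i $ k) = Cxx $ i $ i \<and> (E *v expectation y + c) $ i = \<mu> $ i"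
    for E :: "complex^'m^'n" and c i
    unfolding cond_unbiased_def estimate regression_model.unbiased_iff[OF model] mean_xi ..
  let ?error = "\<lambda>i e. expectation (\<lambda>\<omega>.
    (cmod (regression_model.comb (\<lambda>k \<omega>. (y \<omega> - expectation y) $ k) e \<omega> - (x \<omega> $ i - \<mu> $ i)))\<^sup>2)"
  let ?excess = "\<lambda>e. expectation (\<lambda>\<omega>.
    (cmod (regression_model.comb (\<lambda>k \<omega>. (y \<omega> - expectation y) $ k) e \<omega>))\<^sup>2)"
  have mse: "bayesian_mse M x y (\<lambda>v. E *v v + c) i = ?error i (E $ i)"
    if "cond_unbiased M x y (\<lambda>v. E *v v + c) i" for E :: "complex^'m^'n" and c i
    using that unfolding unbiased bayesian_mse_def estimate by (simp add: algebra_simps)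
  have decomposition: "?error i (E $ i) = ?error i (E_CL $ i) + ?excess (E $ i - E_CL $ i)"
    if "cond_unbiased M x y (\<lambda>v. E *v v + c) i" for E :: "complex^'m^'n" and c i
    using regression_model.constrained_error_decomposition[OF model rG quad E_row quad_nz, where e = "E $ i"] that
    unfolding unbiased mean_xi by blast
  have g\<^sub>0: "g\<^sub>0 = (\<lambda>v. E_CL *v v + (\<mu> - E_CL *v expectation y))"
    by (simp add: g\<^sub>0_def fun_eq_iff matrix_vector_mult_diff_distrib)
  then have g\<^sub>0_affine: "affine_estimator g\<^sub>0"
    unfolding affine_estimator_def by blast
  have g\<^sub>0_unbiased: "cond_unbiased M x y g\<^sub>0 i" for i
  proof -
    have "(\<Sum>k\<in>UNIV. E_CL $ i $ k * b i $ k) = Cxx $ i $ i / quad i * (\<Sum>k\<in>UNIV. r i $ k * b i $ k)"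
      by (simp add: E_row sum_distrib_left mult.assoc)
    then show ?thesis
      unfolding g\<^sub>0 unbiased using quad_nz by (simp flip: quad)
  qed
  have "is_CWCU_LMMSE M x y g \<longleftrightarrow> g = g\<^sub>0" for g
  proof
    assume "g = g\<^sub>0"
    have "bayesian_mse M x y g\<^sub>0 i \<le> bayesian_mse M x y h i"
      if h: "affine_estimator h" "cond_unbiased M x y h i" for h i
    proof -
      obtain E c where h_eq: "h = (\<lambda>v. E *v v + c)"
        using h(1) by (auto simp: affine_estimator_def)
      show ?thesis
        using h(2) g\<^sub>0_unbiased[of i] decomposition[of E c i] unfolding h_eq g\<^sub>0 by (simp add: mse)
    qed
    then show "is_CWCU_LMMSE M x y g"
      using g\<^sub>0_affine g\<^sub>0_unbiased unfolding \<open>g = g\<^sub>0\<close> is_CWCU_LMMSE_def by blast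
  next
    assume g: "is_CWCU_LMMSE M x y g"
    then obtain E c where g_eq: "g = (\<lambda>v. E *v v + c)"
      by (auto simp: is_CWCU_LMMSE_def affine_estimator_def)
    have g_unbiased: "cond_unbiased M x y (\<lambda>v. E *v v + c) i" for i
      using g by (simp add: is_CWCU_LMMSE_def g_eq)
    have "E $ i = E_CL $ i" for i
    proof -
      have "bayesian_mse M x y g i \<le> bayesian_mse M x y g\<^sub>0 i"
        using g g\<^sub>0_affine g\<^sub>0_unbiased unfolding is_CWCU_LMMSE_def by blast
      then have "?excess (E $ i - E_CL $ i) \<le> 0"
        using decomposition[OF g_unbiased[of i]] mse[OF g_unbiased[of i]]
          mse[OF g\<^sub>0_unbiased[of i, unfolded g\<^sub>0]] by (simp add: g_eq g\<^sub>0)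
      moreover have "?excess (E $ i - E_CL $ i) \<ge> 0"
        by simp
      ultimately have "E $ i - E_CL $ i = 0"
        by (intro regression_model.comb_degenerate[OF model]) (rule antisym)
      then show ?thesis
        by simp
    qed
    then have "E = E_CL"
      by (simp add: vec_eq_iff)
    moreover have "E *v expectation y + c = \<mu>"
      using g_unbiased unfolding unbiased by (simp add: vec_eq_iff)
    then have "c = \<mu> - E *v expectation y"
      by (simp add: eq_diff_eq add.commute)
    ultimately show "g = g\<^sub>0"
      by (simp add: g_eq g\<^sub>0)
  qed
  then show ?thesis
    using quad_nz D_real by (simp add: g\<^sub>0_def \<mu>_def)
qed

end
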